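(* Let $\lambda\in\mathbf{k}$, let $(\mathfrak{A},[-,-,-],\mathrm{d})$ be a modified $\lambda$-differential 3-Lie algebra, and let $(\mathfrak{M},[-,-,-]_{\mathfrak{M}}=0,\mathrm{d}_{\mathfrak{M}})$ be a vector space with a linear map $\mathrm{d}_{\mathfrak{M}}:\mathfrak{M}\to\mathfrak{M}$, viewed as a modified $\lambda$-differential 3-Lie algebra with zero bracket. Fix a representation $(\mathfrak{M};\varrho,\mathrm{d}_{\mathfrak{M}})$ of $(\mathfrak{A},[-,-,-],\mathrm{d})$. Then there is a one-to-one correspondence between the equivalence classes of abelian extensions of $(\mathfrak{A},[-,-,-],\mathrm{d})$ by $(\mathfrak{M},[-,-,-]_{\mathfrak{M}},\mathrm{d}_{\mathfrak{M}})$ (whose induced representation is $\varrho$) and the second cohomology group $\mathcal{H}^2_{\mathrm{md3Lie}_\lambda}(\mathfrak{A},\mathfrak{M})$ of $(\mathfrak{A},[-,-,-],\mathrm{d})$ with coefficients in $(\mathfrak{M};\varrho,\mathrm{d}_{\mathfrak{M}})$.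
   Context: Throughout, $\mathbf{k}$ is a field of characteristic zero; all vector spaces and linear maps are over $\mathbf{k}$. 3-Lie algebra: a vector space $\mathfrak{A}$ with a skew-symmetric trilinear bracket $[-,-,-]:\wedge^3\mathfrak{A}\to\mathfrak{A}$ satisfying $[a_1,a_2,[a_3,a_4,a_5]]=[[a_1,a_2,a_3],a_4,a_5]+[a_3,[a_1,a_2,a_4],a_5]+[a_3,a_4,[a_1,a_2,a_5]]$. Modified $\lambda$-differential 3-Lie algebra: a triple $(\mathfrak{A},[-,-,-],\mathrm{d})$ with $(\mathfrak{A},[-,-,-])$ a 3-Lie algebra and $\mathrm{d}:\mathfrak{A}\to\mathfrak{A}$ linear such that $\mathrm{d}[a_1,a_2,a_3]=[\mathrm{d}(a_1),a_2,a_3]+[a_1,\mathrm{d}(a_2),a_3]+[a_1,a_2,\mathrm{d}(a_3)]+\lambda[a_1,a_2,a_3]$. A homomorphism is a linear map preserving brackets and commuting with the operators $\mathrm{d}$; an isomorphism is a bijective homomorphism. Representation of $(\mathfrak{A},[-,-,-],\mathrm{d})$: a triple $(\mathfrak{M};\varrho,\mathrm{d}_{\mathfrak{M}})$ with $\mathfrak{M}$ a vector space, $\varrho:\mathfrak{A}\wedge\mathfrak{A}\to\mathrm{End}(\mathfrak{M})$ skew-symmetric bilinear, $\mathrm{d}_{\mathfrak{M}}\in\mathrm{End}(\mathfrak{M})$, such that $\varrho([a_1,a_2,a_3],a_4)=\varrho(a_2,a_3)\varrho(a_1,a_4)+\varrho(a_3,a_1)\varrho(a_2,a_4)+\varrho(a_1,a_2)\varrho(a_3,a_4)$,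 $\varrho(a_1,a_2)\varrho(a_3,a_4)=\varrho(a_3,a_4)\varrho(a_1,a_2)+\varrho([a_1,a_2,a_3],a_4)+\varrho(a_3,[a_1,a_2,a_4])$, $\mathrm{d}_{\mathfrak{M}}(\varrho(a,b)v)=\varrho(\mathrm{d}(a),b)v+\varrho(a,\mathrm{d}(b))v+\varrho(a,b)\mathrm{d}_{\mathfrak{M}}(v)+\lambda\varrho(a,b)v$. Abelian extension of $(\mathfrak{A},[-,-,-],\mathrm{d})$ by $(\mathfrak{M},0,\mathrm{d}_{\mathfrak{M}})$: a short exact sequence of homomorphisms of modified $\lambda$-differential 3-Lie algebras $0\to\mathfrak{M}\xrightarrow{i}\widehat{\mathfrak{A}}\xrightarrow{p}\mathfrak{A}\to 0$, with middle term $(\widehat{\mathfrak{A}},[-,-,-]_{\widehat{\mathfrak{A}}},\widehat{\mathrm{d}})$, such that (identifying $\mathfrak{M}$ with $i(\mathfrak{M})$) $[x,u,v]_{\widehat{\mathfrak{A}}}=0$ for all $x\in\widehat{\mathfrak{A}}$, $u,v\in\mathfrak{M}$. A section is a linear map $s:\mathfrak{A}\to\widehat{\mathfrak{A}}$ with $p\circ s=\mathrm{id}_{\mathfrak{A}}$. The induced representation is $\varrho(a_1,a_2)u=[s(a_1),s(a_2),u]_{\widehat{\mathfrak{A}}}$, which is independent of the choice of $s$. Two abelian extensions $(\widehat{\mathfrak{A}}_1,i_1,p_1)$ and $(\widehat{\mathfrak{A}}_2,i_2,p_2)$ are equivalent if there is an isomorphism of modified $\lambda$-differential 3-Lie algebras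 $\eta:\widehat{\mathfrak{A}}_1\to\widehat{\mathfrak{A}}_2$ with $\eta\circ i_1=i_2$ and $p_2\circ\eta=p_1$. Second cohomology with coefficients in $(\mathfrak{M};\varrho,\mathrm{d}_{\mathfrak{M}})$: for $g\in\mathrm{Hom}(\mathfrak{A},\mathfrak{M})$ put $(\delta g)(a_1,a_2,a_3)=\varrho(a_2,a_3)g(a_1)+\varrho(a_3,a_1)g(a_2)+\varrho(a_1,a_2)g(a_3)-g([a_1,a_2,a_3])$ and $(\Phi g)(a)=g(\mathrm{d}(a))-\mathrm{d}_{\mathfrak{M}}(g(a))$. For $f\in\mathrm{Hom}(\wedge^3\mathfrak{A},\mathfrak{M})$ put $(\delta f)(a_1,\dots,a_5)=-\varrho(a_4,a_5)f(a_1,a_2,a_3)-\varrho(a_5,a_3)f(a_1,a_2,a_4)+\varrho(a_1,a_2)f(a_3,a_4,a_5)-\varrho(a_3,a_4)f(a_1,a_2,a_5)-f(a_3,a_4,[a_1,a_2,a_5])+f(a_1,a_2,[a_3,a_4,a_5])-f([a_1,a_2,a_3],a_4,a_5)-f(a_3,[a_1,a_2,a_4],a_5)$ and $(\Phi f)(a_1,a_2,a_3)=f(\mathrm{d}(a_1),a_2,a_3)+f(a_1,\mathrm{d}(a_2),a_3)+f(a_1,a_2,\mathrm{d}(a_3))+\lambda f(a_1,a_2,a_3)-\mathrm{d}_{\mathfrak{M}}(f(a_1,a_2,a_3))$. A 2-cocycle is a pair $(f,g)\in\mathrm{Hom}(\wedge^3\mathfrak{A},\mathfrak{M})\oplus\mathrm{Hom}(\mathfrak{A},\mathfrak{M})$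 with $\delta f=0$ and $\delta g+\Phi f=0$; a 2-coboundary is a pair $(\delta h,-\Phi h)$ with $h\in\mathrm{Hom}(\mathfrak{A},\mathfrak{M})$; $\mathcal{H}^2_{\mathrm{md3Lie}_\lambda}(\mathfrak{A},\mathfrak{M})$ is the quotient of 2-cocycles by 2-coboundaries. *)

theory Defs
  imports "HOL-Algebra.Module" "HOL-Algebra.AbelCoset"
begin

text \<open>
  Vector spaces are the modules \<^term>\<open>module K V\<close> over a field \<^term>\<open>K\<close>. Like every HOL-Algebra
  structure they live on a carrier set, and only values on carriers matter. (The components
  \<open>mult\<close> and \<open>one\<close> that module records inherit from rings are never used.)
\<close>

locale char_zero_field = field K for K (structure) +
  assumes char_zero: "(n :: nat) > 0 \<Longrightarrow> [n] \<cdot> \<one> \<noteq> \<zero>"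

definition linear_maps ::
  "('k, 'r) ring_scheme \<Rightarrow> ('k, 'v, 's) module_scheme \<Rightarrow> ('k, 'w, 't) module_scheme \<Rightarrow> ('v \<Rightarrow> 'w) set" where
  "linear_maps K V W =
    {h \<in> carrier V \<rightarrow> carrier W.
      (\<forall>x\<in>carrier V. \<forall>y\<in>carrier V. h (x \<oplus>\<^bsub>V\<^esub> y) = h x \<oplus>\<^bsub>W\<^esub> h y) \<and>
      (\<forall>c\<in>carrier K. \<forall>x\<in>carrier V. h (c \<odot>\<^bsub>V\<^esub> x) = c \<odot>\<^bsub>W\<^esub> h x)}"

definition trilinear ::
  "('k, 'r) ring_scheme \<Rightarrow> ('k, 'u, 's) module_scheme \<Rightarrow> ('k, 'v, 't) module_scheme \<Rightarrow>
   ('k, 'w, 'p) module_scheme \<Rightarrow> ('k, 'x, 'q) module_scheme \<Rightarrow> ('u \<Rightarrow> 'v \<Rightarrow> 'w \<Rightarrow> 'x) \<Rightarrow> bool" where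
  "trilinear K U V W X f \<longleftrightarrow>
    (\<forall>v\<in>carrier V. \<forall>w\<in>carrier W. (\<lambda>u. f u v w) \<in> linear_maps K U X) \<and>
    (\<forall>u\<in>carrier U. \<forall>w\<in>carrier W. (\<lambda>v. f u v w) \<in> linear_maps K V X) \<and>
    (\<forall>u\<in>carrier U. \<forall>v\<in>carrier V. (\<lambda>w. f u v w) \<in> linear_maps K W X)"

text \<open>Skew-symmetry in three arguments; the two adjacent transpositions generate all permutations.\<close>

definition skew3 ::
  "('k, 'v, 's) module_scheme \<Rightarrow> ('k, 'w, 't) module_scheme \<Rightarrow> ('v \<Rightarrow> 'v \<Rightarrow> 'v \<Rightarrow> 'w) \<Rightarrow> bool" where
  "skew3 V W f \<longleftrightarrow>
    (\<forall>a\<in>carrier V. \<forall>b\<in>carrier V. \<forall>c\<in>carrier V.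
      f b a c = \<ominus>\<^bsub>W\<^esub> f a b c \<and> f a c b = \<ominus>\<^bsub>W\<^esub> f a b c)"

record ('k, 'a) diff_3alg = "('k, 'a) module" +
  bracket :: "'a \<Rightarrow> 'a \<Rightarrow> 'a \<Rightarrow> 'a"
  diff :: "'a \<Rightarrow> 'a"

locale three_lie_algebra = field K + module K L for K (structure) and L (structure) +
  assumes bracket_trilinear: "trilinear K L L L L (bracket L)"
    and bracket_skew: "skew3 L L (bracket L)"
    and fundamental_identity:
      "\<lbrakk>a1 \<in> carrier L; a2 \<in> carrier L; a3 \<in> carrier L; a4 \<in> carrier L; a5 \<in> carrier L\<rbrakk> \<Longrightarrow>
        bracket L a1 a2 (bracket L a3 a4 a5) =
          bracket L (bracket L a1 a2 a3) a4 a5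
          \<oplus>\<^bsub>L\<^esub> bracket L a3 (bracket L a1 a2 a4) a5
          \<oplus>\<^bsub>L\<^esub> bracket L a3 a4 (bracket L a1 a2 a5)"

locale md_3lie_algebra = three_lie_algebra K L
  for K (structure) and lam :: 'k and L :: "('k, 'a, 's) diff_3alg_scheme" (structure) +
  assumes diff_linear: "diff L \<in> linear_maps K L L"
    and diff_bracket:
      "\<lbrakk>a1 \<in> carrier L; a2 \<in> carrier L; a3 \<in> carrier L\<rbrakk> \<Longrightarrow>
        diff L (bracket L a1 a2 a3) =
          bracket L (diff L a1) a2 a3 \<oplus>\<^bsub>L\<^esub> bracket L a1 (diff L a2) a3
          \<oplus>\<^bsub>L\<^esub> bracket L a1 a2 (diff L a3) \<oplus>\<^bsub>L\<^esub> lam \<odot>\<^bsub>L\<^esub> bracket L a1 a2 a3"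

definition md_hom ::
  "('k, 'r) ring_scheme \<Rightarrow> ('k, 'a, 's) diff_3alg_scheme \<Rightarrow> ('k, 'b, 't) diff_3alg_scheme \<Rightarrow> ('a \<Rightarrow> 'b) set" where
  "md_hom K L L' =
    {h \<in> linear_maps K L L'.
      (\<forall>a\<in>carrier L. \<forall>b\<in>carrier L. \<forall>c\<in>carrier L.
        h (bracket L a b c) = bracket L' (h a) (h b) (h c)) \<and>
      (\<forall>a\<in>carrier L. h (diff L a) = diff L' (h a))}"

definition md_iso ::
  "('k, 'r) ring_scheme \<Rightarrow> ('k, 'a, 's) diff_3alg_scheme \<Rightarrow> ('k, 'b, 't) diff_3alg_scheme \<Rightarrow> ('a \<Rightarrow> 'b) set" where
  "md_iso K L L' = {h \<in> md_hom K L L'. bij_betw h (carrier L) (carrier L')}"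

text \<open>
  A representation on \<open>(M, diff M)\<close>: the map \<open>rho\<close> into \<open>End M\<close> is curried, so that
  bilinearity of \<open>rho\<close> and linearity of each \<open>rho a b\<close> together are trilinearity.
\<close>

locale md_representation = md_3lie_algebra K lam A + M: module K M
  for K (structure) and lam :: 'k and A :: "('k, 'a, 's) diff_3alg_scheme" (structure)
    and M :: "('k, 'm, 't) diff_3alg_scheme" (structure) and rho :: "'a \<Rightarrow> 'a \<Rightarrow> 'm \<Rightarrow> 'm" +
  assumes diff_M_linear: "diff M \<in> linear_maps K M M"
    and rho_trilinear: "trilinear K A A M M rho"
    and rho_skew:
      "\<lbrakk>a \<in> carrier A; b \<in> carrier A; v \<in> carrier M\<rbrakk> \<Longrightarrow> rho b a v = \<ominus>\<^bsub>M\<^esub> rho a b v"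
    and rho_bracket:
      "\<lbrakk>a1 \<in> carrier A; a2 \<in> carrier A; a3 \<in> carrier A; a4 \<in> carrier A; v \<in> carrier M\<rbrakk> \<Longrightarrow>
        rho (bracket A a1 a2 a3) a4 v =
          rho a2 a3 (rho a1 a4 v) \<oplus>\<^bsub>M\<^esub> rho a3 a1 (rho a2 a4 v) \<oplus>\<^bsub>M\<^esub> rho a1 a2 (rho a3 a4 v)"
    and rho_commute:
      "\<lbrakk>a1 \<in> carrier A; a2 \<in> carrier A; a3 \<in> carrier A; a4 \<in> carrier A; v \<in> carrier M\<rbrakk> \<Longrightarrow>
        rho a1 a2 (rho a3 a4 v) =
          rho a3 a4 (rho a1 a2 v) \<oplus>\<^bsub>M\<^esub> rho (bracket A a1 a2 a3) a4 v
          \<oplus>\<^bsub>M\<^esub> rho a3 (bracket A a1 a2 a4) v"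
    and rho_diff:
      "\<lbrakk>a \<in> carrier A; b \<in> carrier A; v \<in> carrier M\<rbrakk> \<Longrightarrow>
        diff M (rho a b v) =
          rho (diff A a) b v \<oplus>\<^bsub>M\<^esub> rho a (diff A b) v \<oplus>\<^bsub>M\<^esub> rho a b (diff M v)
          \<oplus>\<^bsub>M\<^esub> lam \<odot>\<^bsub>M\<^esub> rho a b v"

section \<open>Abelian extensions\<close>

type_synonym ('k, 'a, 'm, 'e) ext = "('k, 'e) diff_3alg \<times> ('m \<Rightarrow> 'e) \<times> ('e \<Rightarrow> 'a)"

definition sections ::
  "('k, 'r) ring_scheme \<Rightarrow> ('k, 'a, 's) diff_3alg_scheme \<Rightarrow> ('k, 'a, 'm, 'e) ext \<Rightarrow> ('a \<Rightarrow> 'e) set" where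
  "sections K A = (\<lambda>(E, i, p). {s \<in> linear_maps K A E. \<forall>a\<in>carrier A. p (s a) = a})"

definition abelian_extension ::
  "('k, 'r) ring_scheme \<Rightarrow> 'k \<Rightarrow> ('k, 'a, 's) diff_3alg_scheme \<Rightarrow> ('k, 'm, 't) diff_3alg_scheme \<Rightarrow>
   ('k, 'a, 'm, 'e) ext \<Rightarrow> bool" where
  "abelian_extension K lam A M = (\<lambda>(E, i, p).
    md_3lie_algebra K lam E \<and> i \<in> md_hom K M E \<and> p \<in> md_hom K E A \<and>
    inj_on i (carrier M) \<and> i ` carrier M = a_kernel E A p \<and> p ` carrier E = carrier A \<and>
    (\<forall>x\<in>carrier E. \<forall>u\<in>carrier M. \<forall>v\<in>carrier M. bracket E x (i u) (i v) = \<zero>\<^bsub>E\<^esub>))"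

definition induces_representation ::
  "('k, 'r) ring_scheme \<Rightarrow> ('k, 'a, 's) diff_3alg_scheme \<Rightarrow> ('k, 'm, 't) diff_3alg_scheme \<Rightarrow>
   ('a \<Rightarrow> 'a \<Rightarrow> 'm \<Rightarrow> 'm) \<Rightarrow> ('k, 'a, 'm, 'e) ext \<Rightarrow> bool" where
  "induces_representation K A M rho = (\<lambda>(E, i, p).
    \<forall>s\<in>sections K A (E, i, p). \<forall>a\<in>carrier A. \<forall>b\<in>carrier A. \<forall>u\<in>carrier M.
      i (rho a b u) = bracket E (s a) (s b) (i u))"

text \<open>
  The middle terms have an arbitrary carrier set inside the type \<open>'e\<close> and arbitrary operations on it.
\<close>

definition extensions ::
  "('k, 'r) ring_scheme \<Rightarrow> 'k \<Rightarrow> ('k, 'a, 's) diff_3alg_scheme \<Rightarrow> ('k, 'm, 't) diff_3alg_scheme \<Rightarrow>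
   ('a \<Rightarrow> 'a \<Rightarrow> 'm \<Rightarrow> 'm) \<Rightarrow> ('k, 'a, 'm, 'e) ext set" where
  "extensions K lam A M rho =
    {X. abelian_extension K lam A M X \<and> induces_representation K A M rho X}"

definition equivalent_extensions ::
  "('k, 'r) ring_scheme \<Rightarrow> ('k, 'm, 't) diff_3alg_scheme \<Rightarrow>
   ('k, 'a, 'm, 'e) ext \<Rightarrow> ('k, 'a, 'm, 'f) ext \<Rightarrow> bool" where
  "equivalent_extensions K M = (\<lambda>(E1, i1, p1) (E2, i2, p2).
    \<exists>eta \<in> md_iso K E1 E2.
      (\<forall>u\<in>carrier M. eta (i1 u) = i2 u) \<and> (\<forall>x\<in>carrier E1. p2 (eta x) = p1 x))"

definition extension_equiv ::
  "('k, 'r) ring_scheme \<Rightarrow> 'k \<Rightarrow> ('k, 'a, 's) diff_3alg_scheme \<Rightarrow> ('k, 'm, 't) diff_3alg_scheme \<Rightarrow>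
   ('a \<Rightarrow> 'a \<Rightarrow> 'm \<Rightarrow> 'm) \<Rightarrow> ('k, 'a, 'm, 'e) ext rel" where
  "extension_equiv K lam A M rho =
    {(X, Y). X \<in> extensions K lam A M rho \<and> Y \<in> extensions K lam A M rho \<and>
      equivalent_extensions K M X Y}"

section \<open>Second cohomology\<close>

text \<open>Cochains are extensional, so that they are determined by their values on the carrier.\<close>

definition cochains1 ::
  "('k, 'r) ring_scheme \<Rightarrow> ('k, 'a, 's) diff_3alg_scheme \<Rightarrow> ('k, 'm, 't) diff_3alg_scheme \<Rightarrow> ('a \<Rightarrow> 'm) set" where
  "cochains1 K A M = linear_maps K A M \<inter> (carrier A \<rightarrow>\<^sub>E carrier M)"

definition cochains3 ::
  "('k, 'r) ring_scheme \<Rightarrow> ('k, 'a, 's) diff_3alg_scheme \<Rightarrow> ('k, 'm, 't) diff_3alg_scheme \<Rightarrow>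
   ('a \<Rightarrow> 'a \<Rightarrow> 'a \<Rightarrow> 'm) set" where
  "cochains3 K A M =
    {f \<in> carrier A \<rightarrow>\<^sub>E carrier A \<rightarrow>\<^sub>E carrier A \<rightarrow>\<^sub>E carrier M. trilinear K A A A M f \<and> skew3 A M f}"

definition delta1 ::
  "('k, 'a, 's) diff_3alg_scheme \<Rightarrow> ('k, 'm, 't) diff_3alg_scheme \<Rightarrow> ('a \<Rightarrow> 'a \<Rightarrow> 'm \<Rightarrow> 'm) \<Rightarrow>
   ('a \<Rightarrow> 'm) \<Rightarrow> 'a \<Rightarrow> 'a \<Rightarrow> 'a \<Rightarrow> 'm" where
  "delta1 A M rho g a1 a2 a3 =
    rho a2 a3 (g a1) \<oplus>\<^bsub>M\<^esub> rho a3 a1 (g a2) \<oplus>\<^bsub>M\<^esub> rho a1 a2 (g a3) \<ominus>\<^bsub>M\<^esub> g (bracket A a1 a2 a3)"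

definition Phi1 ::
  "('k, 'a, 's) diff_3alg_scheme \<Rightarrow> ('k, 'm, 't) diff_3alg_scheme \<Rightarrow> ('a \<Rightarrow> 'm) \<Rightarrow> 'a \<Rightarrow> 'm" where
  "Phi1 A M g a = g (diff A a) \<ominus>\<^bsub>M\<^esub> diff M (g a)"

definition delta3 ::
  "('k, 'a, 's) diff_3alg_scheme \<Rightarrow> ('k, 'm, 't) diff_3alg_scheme \<Rightarrow> ('a \<Rightarrow> 'a \<Rightarrow> 'm \<Rightarrow> 'm) \<Rightarrow>
   ('a \<Rightarrow> 'a \<Rightarrow> 'a \<Rightarrow> 'm) \<Rightarrow> 'a \<Rightarrow> 'a \<Rightarrow> 'a \<Rightarrow> 'a \<Rightarrow> 'a \<Rightarrow> 'm" where
  "delta3 A M rho f a1 a2 a3 a4 a5 =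
    \<ominus>\<^bsub>M\<^esub> rho a4 a5 (f a1 a2 a3) \<ominus>\<^bsub>M\<^esub> rho a5 a3 (f a1 a2 a4)
    \<oplus>\<^bsub>M\<^esub> rho a1 a2 (f a3 a4 a5) \<ominus>\<^bsub>M\<^esub> rho a3 a4 (f a1 a2 a5)
    \<ominus>\<^bsub>M\<^esub> f a3 a4 (bracket A a1 a2 a5) \<oplus>\<^bsub>M\<^esub> f a1 a2 (bracket A a3 a4 a5)
    \<ominus>\<^bsub>M\<^esub> f (bracket A a1 a2 a3) a4 a5 \<ominus>\<^bsub>M\<^esub> f a3 (bracket A a1 a2 a4) a5"

definition Phi3 ::
  "'k \<Rightarrow> ('k, 'a, 's) diff_3alg_scheme \<Rightarrow> ('k, 'm, 't) diff_3alg_scheme \<Rightarrow>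
   ('a \<Rightarrow> 'a \<Rightarrow> 'a \<Rightarrow> 'm) \<Rightarrow> 'a \<Rightarrow> 'a \<Rightarrow> 'a \<Rightarrow> 'm" where
  "Phi3 lam A M f a1 a2 a3 =
    f (diff A a1) a2 a3 \<oplus>\<^bsub>M\<^esub> f a1 (diff A a2) a3 \<oplus>\<^bsub>M\<^esub> f a1 a2 (diff A a3)
    \<oplus>\<^bsub>M\<^esub> lam \<odot>\<^bsub>M\<^esub> f a1 a2 a3 \<ominus>\<^bsub>M\<^esub> diff M (f a1 a2 a3)"

definition cocycles ::
  "('k, 'r) ring_scheme \<Rightarrow> 'k \<Rightarrow> ('k, 'a, 's) diff_3alg_scheme \<Rightarrow> ('k, 'm, 't) diff_3alg_scheme \<Rightarrow>
   ('a \<Rightarrow> 'a \<Rightarrow> 'm \<Rightarrow> 'm) \<Rightarrow> (('a \<Rightarrow> 'a \<Rightarrow> 'a \<Rightarrow> 'm) \<times> ('a \<Rightarrow> 'm)) set" where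
  "cocycles K lam A M rho =
    {(f, g). f \<in> cochains3 K A M \<and> g \<in> cochains1 K A M \<and>
      (\<forall>a1\<in>carrier A. \<forall>a2\<in>carrier A. \<forall>a3\<in>carrier A. \<forall>a4\<in>carrier A. \<forall>a5\<in>carrier A.
        delta3 A M rho f a1 a2 a3 a4 a5 = \<zero>\<^bsub>M\<^esub>) \<and>
      (\<forall>a1\<in>carrier A. \<forall>a2\<in>carrier A. \<forall>a3\<in>carrier A.
        delta1 A M rho g a1 a2 a3 \<oplus>\<^bsub>M\<^esub> Phi3 lam A M f a1 a2 a3 = \<zero>\<^bsub>M\<^esub>)}"

definition coboundaries ::
  "('k, 'r) ring_scheme \<Rightarrow> ('k, 'a, 's) diff_3alg_scheme \<Rightarrow> ('k, 'm, 't) diff_3alg_scheme \<Rightarrow>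
   ('a \<Rightarrow> 'a \<Rightarrow> 'm \<Rightarrow> 'm) \<Rightarrow> (('a \<Rightarrow> 'a \<Rightarrow> 'a \<Rightarrow> 'm) \<times> ('a \<Rightarrow> 'm)) set" where
  "coboundaries K A M rho =
    (\<lambda>h. (\<lambda>a\<in>carrier A. \<lambda>b\<in>carrier A. \<lambda>c\<in>carrier A. delta1 A M rho h a b c,
          \<lambda>a\<in>carrier A. \<ominus>\<^bsub>M\<^esub> Phi1 A M h a)) ` cochains1 K A M"

text \<open>The group of 2-cocycles under pointwise addition, written multiplicatively so that the quotient group is \<open>Mod\<close>.\<close>

definition cocycle_group ::
  "('k, 'r) ring_scheme \<Rightarrow> 'k \<Rightarrow> ('k, 'a, 's) diff_3alg_scheme \<Rightarrow> ('k, 'm, 't) diff_3alg_scheme \<Rightarrow>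
   ('a \<Rightarrow> 'a \<Rightarrow> 'm \<Rightarrow> 'm) \<Rightarrow> (('a \<Rightarrow> 'a \<Rightarrow> 'a \<Rightarrow> 'm) \<times> ('a \<Rightarrow> 'm)) monoid" where
  "cocycle_group K lam A M rho =
    \<lparr>carrier = cocycles K lam A M rho,
     mult = (\<lambda>(f, g) (f', g').
       (\<lambda>a\<in>carrier A. \<lambda>b\<in>carrier A. \<lambda>c\<in>carrier A. f a b c \<oplus>\<^bsub>M\<^esub> f' a b c,
        \<lambda>a\<in>carrier A. g a \<oplus>\<^bsub>M\<^esub> g' a)),
     one = (\<lambda>a\<in>carrier A. \<lambda>b\<in>carrier A. \<lambda>c\<in>carrier A. \<zero>\<^bsub>M\<^esub>, \<lambda>a\<in>carrier A. \<zero>\<^bsub>M\<^esub>)\<rparr>"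

definition H2 ::
  "('k, 'r) ring_scheme \<Rightarrow> 'k \<Rightarrow> ('k, 'a, 's) diff_3alg_scheme \<Rightarrow> ('k, 'm, 't) diff_3alg_scheme \<Rightarrow>
   ('a \<Rightarrow> 'a \<Rightarrow> 'm \<Rightarrow> 'm) \<Rightarrow> (('a \<Rightarrow> 'a \<Rightarrow> 'a \<Rightarrow> 'm) \<times> ('a \<Rightarrow> 'm)) set monoid" where
  "H2 K lam A M rho = cocycle_group K lam A M rho Mod coboundaries K A M rho"

text \<open>
  The cocycle of an extension with a chosen section \<open>s\<close>: it measures the failure of \<open>s\<close> to preserve
  the bracket and the operator. Both differences lie in \<open>i ` carrier M\<close> and are pulled back to \<open>M\<close>.
\<close>

definition section_cocycle ::
  "('k, 'a, 's) diff_3alg_scheme \<Rightarrow> ('k, 'm, 't) diff_3alg_scheme \<Rightarrow> ('k, 'a, 'm, 'e) ext \<Rightarrow>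
   ('a \<Rightarrow> 'e) \<Rightarrow> ('a \<Rightarrow> 'a \<Rightarrow> 'a \<Rightarrow> 'm) \<times> ('a \<Rightarrow> 'm)" where
  "section_cocycle A M = (\<lambda>(E, i, p) s.
    (\<lambda>a\<in>carrier A. \<lambda>b\<in>carrier A. \<lambda>c\<in>carrier A.
       inv_into (carrier M) i (bracket E (s a) (s b) (s c) \<ominus>\<^bsub>E\<^esub> s (bracket A a b c)),
     \<lambda>a\<in>carrier A. inv_into (carrier M) i (diff E (s a) \<ominus>\<^bsub>E\<^esub> s (diff A a))))"

end

theory Submission
  imports Defs
begin

text \<open>
  A section \<open>s\<close> splits every element of the middle term uniquely as \<open>s a \<oplus> i u\<close>. In these coordinates the
  bracket and the operator are determined by \<open>rho\<close> and the section cocycle \<open>(f, g)\<close>, and the axioms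
  of a modified differential 3-Lie algebra amount to the cocycle equations. Replacing \<open>s\<close> by \<open>s \<oplus> i \<circ> h\<close>
  adds the coboundary of \<open>h\<close>, so the coset of \<open>(f, g)\<close> depends only on the extension. Equivalences
  transport sections without changing their cocycles; conversely, if the cosets of two extensions
  agree, suitable sections have equal cocycles, and matching coordinates is an equivalence. Finally,
  every cocycle defines such a structure on \<open>A \<times> M\<close>.
\<close>

section \<open>Linear maps\<close>

text \<open>All middle terms are taken inside one type \<open>'e\<close>, which need not contain
  pairs. This is why cocycles are realised along an injection \<open>j\<close>: the structure on
  \<open>A \<times> M\<close> is carried over to the image of \<open>j\<close>. Its formulas are
  forced, being those that the bracket and the operator of any extension take in the coordinates of
  a section. The axioms reduce to the cocycle equations because the \<open>M\<close>-coordinate of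
  each axiom is additive in the entries from \<open>M\<close>. The part that depends on those
  entries is an identity of the representation, and only the part that depends on the section values
  alone sees \<open>f\<close> and \<open>g\<close>. Sections matter only on the carrier and are
  arbitrary elsewhere, whereas elements of the cohomology group are sets of functions; since
  cocycles are restricted to the carrier, agreement there becomes equality of cosets.\<close>

lemma linear_mapsI:
  assumes "\<And>x. x \<in> carrier V \<Longrightarrow> h x \<in> carrier W"
    and "\<And>x y. \<lbrakk>x \<in> carrier V; y \<in> carrier V\<rbrakk> \<Longrightarrow> h (x \<oplus>\<^bsub>V\<^esub> y) = h x \<oplus>\<^bsub>W\<^esub> h y"
    and "\<And>c x. \<lbrakk>c \<in> carrier K; x \<in> carrier V\<rbrakk> \<Longrightarrow> h (c \<odot>\<^bsub>V\<^esub> x) = c \<odot>\<^bsub>W\<^esub> h x"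
  shows "h \<in> linear_maps K V W"
  using assms by (auto simp: linear_maps_def)

lemma linear_maps_closed: "\<lbrakk>h \<in> linear_maps K V W; x \<in> carrier V\<rbrakk> \<Longrightarrow> h x \<in> carrier W"
  and linear_maps_add:
    "\<lbrakk>h \<in> linear_maps K V W; x \<in> carrier V; y \<in> carrier V\<rbrakk> \<Longrightarrow> h (x \<oplus>\<^bsub>V\<^esub> y) = h x \<oplus>\<^bsub>W\<^esub> h y"
  and linear_maps_smult:
    "\<lbrakk>h \<in> linear_maps K V W; c \<in> carrier K; x \<in> carrier V\<rbrakk> \<Longrightarrow> h (c \<odot>\<^bsub>V\<^esub> x) = c \<odot>\<^bsub>W\<^esub> h x"
  by (auto simp: linear_maps_def)

lemma linear_maps_abelian_group_hom:
  assumes "h \<in> linear_maps K V W" "abelian_group V" "abelian_group W"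
  shows "abelian_group_hom V W h"
  using assms
  by (intro abelian_group_homI group_hom.intro group_hom_axioms.intro abelian_group.a_group)
    (auto simp: linear_maps_def hom_def)

lemma
  assumes "h \<in> linear_maps K V W" "abelian_group V" "abelian_group W"
  shows linear_maps_zero: "h \<zero>\<^bsub>V\<^esub> = \<zero>\<^bsub>W\<^esub>"
    and linear_maps_uminus: "x \<in> carrier V \<Longrightarrow> h (\<ominus>\<^bsub>V\<^esub> x) = \<ominus>\<^bsub>W\<^esub> h x"
    and linear_maps_minus:
      "\<lbrakk>x \<in> carrier V; y \<in> carrier V\<rbrakk> \<Longrightarrow> h (x \<ominus>\<^bsub>V\<^esub> y) = h x \<ominus>\<^bsub>W\<^esub> h y"
proof -
  interpret abelian_group_hom V W h
    by (rule linear_maps_abelian_group_hom) fact+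
  show "h \<zero>\<^bsub>V\<^esub> = \<zero>\<^bsub>W\<^esub>" by (rule hom_zero)
  show uminus: "h (\<ominus>\<^bsub>V\<^esub> x) = \<ominus>\<^bsub>W\<^esub> h x" if "x \<in> carrier V" for x using that by simp
  show "h (x \<ominus>\<^bsub>V\<^esub> y) = h x \<ominus>\<^bsub>W\<^esub> h y" if "x \<in> carrier V" "y \<in> carrier V"
    using that by (simp add: a_minus_def)
qed

lemma linear_maps_comp:
  "\<lbrakk>g \<in> linear_maps K U V; h \<in> linear_maps K V W\<rbrakk> \<Longrightarrow> (\<lambda>x. h (g x)) \<in> linear_maps K U W"
  by (auto simp: linear_maps_def Pi_iff)

lemma linear_maps_plus:
  assumes "module K V" "module K W" "g \<in> linear_maps K V W" "h \<in> linear_maps K V W"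
  shows "(\<lambda>x. g x \<oplus>\<^bsub>W\<^esub> h x) \<in> linear_maps K V W"
proof -
  interpret W: module K W by fact
  show ?thesis
    using assms(3,4)
    by (intro linear_mapsI)
      (auto simp: linear_maps_closed linear_maps_add linear_maps_smult W.M.a_ac W.smult_r_distr)
qed

lemma linear_maps_diff:
  assumes "module K V" "module K W" "g \<in> linear_maps K V W" "h \<in> linear_maps K V W"
  shows "(\<lambda>x. g x \<ominus>\<^bsub>W\<^esub> h x) \<in> linear_maps K V W"
proof -
  interpret W: module K W by fact
  show ?thesis
    using assms(3,4)
    by (intro linear_mapsI)
      (auto simp: linear_maps_closed linear_maps_add linear_maps_smult W.M.a_ac W.smult_r_distr
        W.M.minus_eq W.M.minus_add W.smult_r_minus)
qed

text \<open>Injectivity reflects linearity: \<open>i\<close> turns the identities required of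
  \<open>g\<close> into those that hold for \<open>y\<close>. This is how maps obtained from
  \<open>inv_into\<close> are seen to be linear.\<close>

lemma linear_maps_lift_inj:
  assumes "module K U" "module K V" and i: "i \<in> linear_maps K V W" "inj_on i (carrier V)"
    and y: "y \<in> linear_maps K U W"
    and g: "\<And>x. x \<in> carrier U \<Longrightarrow> g x \<in> carrier V" "\<And>x. x \<in> carrier U \<Longrightarrow> i (g x) = y x"
  shows "g \<in> linear_maps K U V"
proof -
  interpret U: module K U by fact
  interpret V: module K V by fact
  show ?thesis
    using g
    by (intro linear_mapsI inj_onD[OF i(2)])
      (simp_all add: linear_maps_add[OF i(1)] linear_maps_smult[OF i(1)]
        linear_maps_add[OF y] linear_maps_smult[OF y])
qed

section \<open>Trilinear maps\<close>

lemma trilinearI: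
  assumes "\<And>v w. \<lbrakk>v \<in> carrier V; w \<in> carrier W\<rbrakk> \<Longrightarrow> (\<lambda>u. f u v w) \<in> linear_maps K U X"
    and "\<And>u w. \<lbrakk>u \<in> carrier U; w \<in> carrier W\<rbrakk> \<Longrightarrow> (\<lambda>v. f u v w) \<in> linear_maps K V X"
    and "\<And>u v. \<lbrakk>u \<in> carrier U; v \<in> carrier V\<rbrakk> \<Longrightarrow> (\<lambda>w. f u v w) \<in> linear_maps K W X"
  shows "trilinear K U V W X f"
  using assms by (auto simp: trilinear_def)

lemma trilinearD:
  assumes "trilinear K U V W X f"
  shows "\<lbrakk>v \<in> carrier V; w \<in> carrier W\<rbrakk> \<Longrightarrow> (\<lambda>u. f u v w) \<in> linear_maps K U X"
    and "\<lbrakk>u \<in> carrier U; w \<in> carrier W\<rbrakk> \<Longrightarrow> (\<lambda>v. f u v w) \<in> linear_maps K V X"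
    and "\<lbrakk>u \<in> carrier U; v \<in> carrier V\<rbrakk> \<Longrightarrow> (\<lambda>w. f u v w) \<in> linear_maps K W X"
  using assms by (auto simp: trilinear_def)

lemma trilinear_closed:
  "\<lbrakk>trilinear K U V W X f; u \<in> carrier U; v \<in> carrier V; w \<in> carrier W\<rbrakk> \<Longrightarrow> f u v w \<in> carrier X"
  using linear_maps_closed[OF trilinearD(1)] by metis

lemma trilinear_add:
  assumes "trilinear K U V W X f" "u \<in> carrier U" "v \<in> carrier V" "w \<in> carrier W"
  shows "u' \<in> carrier U \<Longrightarrow> f (u \<oplus>\<^bsub>U\<^esub> u') v w = f u v w \<oplus>\<^bsub>X\<^esub> f u' v w"
    and "v' \<in> carrier V \<Longrightarrow> f u (v \<oplus>\<^bsub>V\<^esub> v') w = f u v w \<oplus>\<^bsub>X\<^esub> f u v' w"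
    and "w' \<in> carrier W \<Longrightarrow> f u v (w \<oplus>\<^bsub>W\<^esub> w') = f u v w \<oplus>\<^bsub>X\<^esub> f u v w'"
  using trilinearD[OF assms(1)] assms(2-4) by (auto simp: linear_maps_def)

lemma trilinear_smult:
  assumes "trilinear K U V W X f" "c \<in> carrier K" "u \<in> carrier U" "v \<in> carrier V" "w \<in> carrier W"
  shows "f (c \<odot>\<^bsub>U\<^esub> u) v w = c \<odot>\<^bsub>X\<^esub> f u v w"
    and "f u (c \<odot>\<^bsub>V\<^esub> v) w = c \<odot>\<^bsub>X\<^esub> f u v w"
    and "f u v (c \<odot>\<^bsub>W\<^esub> w) = c \<odot>\<^bsub>X\<^esub> f u v w"
  using trilinearD[OF assms(1)] assms(2-5) by (auto simp: linear_maps_def)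

lemma trilinear_zero:
  assumes "trilinear K U V W X f" "abelian_group U" "abelian_group V" "abelian_group W" "abelian_group X"
  shows "\<lbrakk>v \<in> carrier V; w \<in> carrier W\<rbrakk> \<Longrightarrow> f \<zero>\<^bsub>U\<^esub> v w = \<zero>\<^bsub>X\<^esub>"
    and "\<lbrakk>u \<in> carrier U; w \<in> carrier W\<rbrakk> \<Longrightarrow> f u \<zero>\<^bsub>V\<^esub> w = \<zero>\<^bsub>X\<^esub>"
    and "\<lbrakk>u \<in> carrier U; v \<in> carrier V\<rbrakk> \<Longrightarrow> f u v \<zero>\<^bsub>W\<^esub> = \<zero>\<^bsub>X\<^esub>"
  using linear_maps_zero[OF trilinearD(1)[OF assms(1)]] linear_maps_zero[OF trilinearD(2)[OF assms(1)]]
    linear_maps_zero[OF trilinearD(3)[OF assms(1)]] assms(2-5) by auto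

section \<open>Splitting a surjection of vector spaces\<close>

text \<open>The section is inverse to \<open>p\<close> on a maximal subspace that meets the kernel of \<open>p\<close> trivially.\<close>

lemma linear_section_exists:
  fixes K :: "('k, 'r) ring_scheme" (structure)
  assumes "field K" "module K V" "module K W"
    and p: "p \<in> linear_maps K V W" "p ` carrier V = carrier W"
  shows "\<exists>s \<in> linear_maps K W V. \<forall>y \<in> carrier W. p (s y) = y"
proof -
  interpret K: field K by fact
  interpret V: module K V by fact
  interpret W: module K W by fact
  note p_lin = linear_maps_closed[OF p(1)] linear_maps_add[OF p(1)] linear_maps_smult[OF p(1)]
  have p_zero: "p \<zero>\<^bsub>V\<^esub> = \<zero>\<^bsub>W\<^esub>"
    by (rule linear_maps_zero[OF p(1)]) unfold_locales
  define \<S> where "\<S> = {S. S \<subseteq> carrier V \<and> \<zero>\<^bsub>V\<^esub> \<in> S \<and> (\<forall>x\<in>S. \<forall>y\<in>S. x \<oplus>\<^bsub>V\<^esub> y \<in> S) \<and>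
    (\<forall>c\<in>carrier K. \<forall>x\<in>S. c \<odot>\<^bsub>V\<^esub> x \<in> S) \<and> (\<forall>x\<in>S. p x = \<zero>\<^bsub>W\<^esub> \<longrightarrow> x = \<zero>\<^bsub>V\<^esub>)}"
  have "\<exists>S\<in>\<S>. \<forall>T\<in>\<S>. S \<subseteq> T \<longrightarrow> T = S"
  proof (rule subset_Zorn_nonempty)
    show "\<S> \<noteq> {}"
      by (rule ex_in_conv[THEN iffD1], rule exI[of _ "{\<zero>\<^bsub>V\<^esub>}"]) (auto simp: \<S>_def)
  next
    fix \<C> assume ne: "\<C> \<noteq> {}" and chain: "subset.chain \<S> \<C>"
    then have sub: "\<And>S. S \<in> \<C> \<Longrightarrow> S \<in> \<S>" by (auto simp: subset.chain_def)
    \<comment> \<open>Closure under addition involves two elements, possibly from different members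
      of the chain; the larger member contains both.\<close>
    have pair: "\<exists>S\<in>\<C>. x \<in> S \<and> y \<in> S" if "x \<in> \<Union>\<C>" "y \<in> \<Union>\<C>" for x y
    proof -
      obtain X Y where *: "X \<in> \<C>" "x \<in> X" "Y \<in> \<C>" "y \<in> Y" using \<open>x \<in> \<Union>\<C>\<close> \<open>y \<in> \<Union>\<C>\<close> by blast
      have "X \<subseteq> Y \<or> Y \<subseteq> X" using chain * unfolding subset_chain_def by blast
      then show ?thesis using * by blast
    qed
    have sub': "S \<subseteq> carrier V" "\<zero>\<^bsub>V\<^esub> \<in> S" "\<And>x y. \<lbrakk>x \<in> S; y \<in> S\<rbrakk> \<Longrightarrow> x \<oplus>\<^bsub>V\<^esub> y \<in> S"
      "\<And>c x. \<lbrakk>c \<in> carrier K; x \<in> S\<rbrakk> \<Longrightarrow> c \<odot>\<^bsub>V\<^esub> x \<in> S" "\<And>x. \<lbrakk>x \<in> S; p x = \<zero>\<^bsub>W\<^esub>\<rbrakk> \<Longrightarrow> x = \<zero>\<^bsub>V\<^esub>"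
      if "S \<in> \<C>" for S
      using sub[OF that] by (auto simp: \<S>_def)
    show "\<Union>\<C> \<in> \<S>"
      unfolding \<S>_def
    proof (intro CollectI conjI ballI impI)
      show "\<Union>\<C> \<subseteq> carrier V" using sub'(1) by blast
      show "\<zero>\<^bsub>V\<^esub> \<in> \<Union>\<C>" using sub'(2) ne by blast
      show "x \<oplus>\<^bsub>V\<^esub> y \<in> \<Union>\<C>" if "x \<in> \<Union>\<C>" "y \<in> \<Union>\<C>" for x y
        using pair[OF that] sub'(3) by blast
      show "c \<odot>\<^bsub>V\<^esub> x \<in> \<Union>\<C>" if "c \<in> carrier K" "x \<in> \<Union>\<C>" for c x
        using that sub'(4) by blast
      show "x = \<zero>\<^bsub>V\<^esub>" if "x \<in> \<Union>\<C>" "p x = \<zero>\<^bsub>W\<^esub>" for x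
        using that sub'(5) by blast
    qed
  qed
  then obtain S where S: "S \<in> \<S>" and max: "\<And>T. T \<in> \<S> \<Longrightarrow> S \<subseteq> T \<Longrightarrow> T = S" by blast
  have sub: "\<And>x. x \<in> S \<Longrightarrow> x \<in> carrier V" and zero: "\<zero>\<^bsub>V\<^esub> \<in> S"
    and add: "\<And>x y. x \<in> S \<Longrightarrow> y \<in> S \<Longrightarrow> x \<oplus>\<^bsub>V\<^esub> y \<in> S"
    and smult: "\<And>c x. c \<in> carrier K \<Longrightarrow> x \<in> S \<Longrightarrow> c \<odot>\<^bsub>V\<^esub> x \<in> S"
    and triv: "\<And>x. x \<in> S \<Longrightarrow> p x = \<zero>\<^bsub>W\<^esub> \<Longrightarrow> x = \<zero>\<^bsub>V\<^esub>"
    using S by (auto simp: \<S>_def)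
  have onto: "\<exists>w\<in>S. p w = y" if y: "y \<in> carrier W" for y
  proof (rule ccontr)
    assume no: "\<not> (\<exists>w\<in>S. p w = y)"
    obtain x where x: "x \<in> carrier V" "p x = y" using p(2) y by (metis imageE)
    \<comment> \<open>\<open>T\<close> is the sum of \<open>S\<close> and the line through a
      preimage \<open>x\<close> of the missed \<open>y\<close>. If it still meets the kernel
      trivially, maximality gives \<open>T = S\<close>, so that \<open>x\<close> lies in
      \<open>S\<close> and \<open>y\<close> is hit after all.\<close>
    define T where "T = {w \<oplus>\<^bsub>V\<^esub> c \<odot>\<^bsub>V\<^esub> x | w c. w \<in> S \<and> c \<in> carrier K}"
    have TI: "w \<oplus>\<^bsub>V\<^esub> c \<odot>\<^bsub>V\<^esub> x \<in> T" if "w \<in> S" "c \<in> carrier K" for w c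
      using that by (auto simp: T_def)
    have "T \<in> \<S>"
      unfolding \<S>_def
    proof (intro CollectI conjI ballI impI)
      show "T \<subseteq> carrier V" using x sub by (auto simp: T_def)
      show "\<zero>\<^bsub>V\<^esub> \<in> T"
        using TI[OF zero K.zero_closed] x by simp
    next
      fix u v assume "u \<in> T" "v \<in> T"
      then obtain w c w' c' where *: "u = w \<oplus>\<^bsub>V\<^esub> c \<odot>\<^bsub>V\<^esub> x" "w \<in> S" "c \<in> carrier K"
        "v = w' \<oplus>\<^bsub>V\<^esub> c' \<odot>\<^bsub>V\<^esub> x" "w' \<in> S" "c' \<in> carrier K" by (auto simp: T_def)
      then have "u \<oplus>\<^bsub>V\<^esub> v = (w \<oplus>\<^bsub>V\<^esub> w') \<oplus>\<^bsub>V\<^esub> (c \<oplus> c') \<odot>\<^bsub>V\<^esub> x"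
        using sub x by (simp add: V.smult_l_distr V.M.a_ac)
      then show "u \<oplus>\<^bsub>V\<^esub> v \<in> T" using * by (simp add: TI add)
    next
      fix d u assume d: "d \<in> carrier K" and "u \<in> T"
      then obtain w c where *: "u = w \<oplus>\<^bsub>V\<^esub> c \<odot>\<^bsub>V\<^esub> x" "w \<in> S" "c \<in> carrier K"
        by (auto simp: T_def)
      then have "d \<odot>\<^bsub>V\<^esub> u = d \<odot>\<^bsub>V\<^esub> w \<oplus>\<^bsub>V\<^esub> (d \<otimes> c) \<odot>\<^bsub>V\<^esub> x"
        using sub x d by (simp add: V.smult_r_distr V.smult_assoc1)
      then show "d \<odot>\<^bsub>V\<^esub> u \<in> T" using * d by (simp add: TI smult)
    next
      fix u assume "u \<in> T" and u0: "p u = \<zero>\<^bsub>W\<^esub>"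
      then obtain w c where *: "u = w \<oplus>\<^bsub>V\<^esub> c \<odot>\<^bsub>V\<^esub> x" "w \<in> S" "c \<in> carrier K"
        by (auto simp: T_def)
      then have sum: "p w \<oplus>\<^bsub>W\<^esub> c \<odot>\<^bsub>W\<^esub> y = \<zero>\<^bsub>W\<^esub>" using u0 x sub by (simp add: p_lin)
      \<comment> \<open>For \<open>c\<close> nonzero, division by \<open>c\<close> would exhibit
        \<open>y\<close> as the image of a multiple of \<open>w\<close>, hence of an element of
        \<open>S\<close>.\<close>
      have "c = \<zero>"
      proof (rule ccontr)
        assume "c \<noteq> \<zero>"
        then have c: "inv c \<in> carrier K" "inv c \<otimes> c = \<one>"
          using *(3) K.field_Units K.Units_inv_closed K.Units_l_inv by auto
        have "p w = \<ominus>\<^bsub>W\<^esub> (c \<odot>\<^bsub>W\<^esub> y)"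
          using sum * y sub p_lin by (intro W.M.minus_equality[symmetric]) auto
        then have "p ((\<ominus> (inv c)) \<odot>\<^bsub>V\<^esub> w) = inv c \<odot>\<^bsub>W\<^esub> (c \<odot>\<^bsub>W\<^esub> y)"
          using * sub c y by (simp add: p_lin W.smult_l_minus W.smult_r_minus)
        also have "\<dots> = y"
          using * c y by (simp flip: W.smult_assoc1)
        finally show False using no smult[of "\<ominus> (inv c)" w] c * by auto
      qed
      with sum * x y sub have "p w = \<zero>\<^bsub>W\<^esub>" by (simp add: p_lin)
      with * have "w = \<zero>\<^bsub>V\<^esub>" by (simp add: triv)
      with * \<open>c = \<zero>\<close> x show "u = \<zero>\<^bsub>V\<^esub>" by simp
    qed
    moreover have "S \<subseteq> T"
    proof
      fix w assume "w \<in> S"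
      moreover from this have "w = w \<oplus>\<^bsub>V\<^esub> \<zero> \<odot>\<^bsub>V\<^esub> x" using sub x by simp
      ultimately show "w \<in> T" using TI[OF _ K.zero_closed] by metis
    qed
    ultimately have "T = S" by (rule max)
    moreover have "x = \<zero>\<^bsub>V\<^esub> \<oplus>\<^bsub>V\<^esub> \<one> \<odot>\<^bsub>V\<^esub> x" using x by simp
    then have "x \<in> T" using TI[OF zero K.one_closed] by metis
    ultimately show False using no x by metis
  qed
  have inj: "inj_on p S"
  proof (rule inj_onI)
    fix x y assume *: "x \<in> S" "y \<in> S" "p x = p y"
    \<comment> \<open>Negation is scaling by minus one, so closure of \<open>S\<close> under scaling
      also gives closure under subtraction.\<close>
    have m: "\<ominus>\<^bsub>V\<^esub> y = (\<ominus> \<one>) \<odot>\<^bsub>V\<^esub> y" using * sub by (simp add: V.smult_l_minus)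
    have "x \<oplus>\<^bsub>V\<^esub> \<ominus>\<^bsub>V\<^esub> y \<in> S" unfolding m using * by (intro add smult) auto
    moreover have "p (x \<oplus>\<^bsub>V\<^esub> \<ominus>\<^bsub>V\<^esub> y) = \<zero>\<^bsub>W\<^esub>"
      using * sub by (simp add: p_lin linear_maps_uminus[OF p(1) V.M.abelian_group_axioms
        W.M.abelian_group_axioms] W.M.r_neg)
    ultimately have "x \<oplus>\<^bsub>V\<^esub> \<ominus>\<^bsub>V\<^esub> y = \<zero>\<^bsub>V\<^esub>" by (rule triv)
    then show "x = y" using * sub V.M.minus_equality[of x "\<ominus>\<^bsub>V\<^esub> y"] by simp
  qed
  define s where "s = inv_into S p"
  have img: "p ` S = carrier W" using onto sub p_lin(1) by (auto simp: image_iff)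
  have s: "s y \<in> S" "p (s y) = y" if "y \<in> carrier W" for y
    using that img by (auto simp: s_def inv_into_into f_inv_into_f)
  \<comment> \<open>Both sides of each linearity law lie in \<open>S\<close> and have the same image
    under \<open>p\<close>, which is injective on \<open>S\<close>.\<close>
  have "s \<in> linear_maps K W V"
    using s sub add smult by (intro linear_mapsI inj_onD[OF inj]) (auto simp: p_lin)
  then show ?thesis using s(2) by (metis (no_types))
qed

section \<open>Representations and twisted products\<close>

context md_3lie_algebra
begin

lemma bracket_closed [simp]:
  "\<lbrakk>a \<in> carrier L; b \<in> carrier L; c \<in> carrier L\<rbrakk> \<Longrightarrow> bracket L a b c \<in> carrier L"
  by (rule trilinear_closed[OF bracket_trilinear])

lemma diff_closed [simp]: "a \<in> carrier L \<Longrightarrow> diff L a \<in> carrier L"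
  by (rule linear_maps_closed[OF diff_linear])

lemma bracket_swap:
  assumes "a \<in> carrier L" "b \<in> carrier L" "c \<in> carrier L"
  shows "bracket L b a c = \<ominus>\<^bsub>L\<^esub> bracket L a b c" "bracket L a c b = \<ominus>\<^bsub>L\<^esub> bracket L a b c"
  using bracket_skew assms unfolding skew3_def by blast+

lemmas bracket_add = trilinear_add[OF bracket_trilinear]
lemmas bracket_smult = trilinear_smult[OF bracket_trilinear]
lemmas diff_add = linear_maps_add[OF diff_linear]
lemmas diff_smult = linear_maps_smult[OF diff_linear]

end

section \<open>Coefficients in a representation, and the twisted operations\<close>

locale coefficient_system = K: field K
  for K :: "('k, 'r) ring_scheme" (structure) and A :: "('k, 'a, 's) diff_3alg_scheme"
    and M :: "('k, 'm, 't) diff_3alg_scheme" +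
  fixes lam :: 'k and rho :: "'a \<Rightarrow> 'a \<Rightarrow> 'm \<Rightarrow> 'm"
  assumes rep: "md_representation K lam A M rho"
    and lam_closed [simp]: "lam \<in> carrier K"
    and bracket_M: "\<lbrakk>u \<in> carrier M; v \<in> carrier M; w \<in> carrier M\<rbrakk> \<Longrightarrow> bracket M u v w = \<zero>\<^bsub>M\<^esub>"
begin

sublocale A: md_3lie_algebra K lam A
  using rep by (rule md_representation.axioms)

sublocale M: module K M
  using rep by (rule md_representation.axioms)

lemmas diff_M_linear = md_representation.diff_M_linear[OF rep]
  and rho_trilinear = md_representation.rho_trilinear[OF rep]
  and rho_skew = md_representation.rho_skew[OF rep]
  and rho_bracket = md_representation.rho_bracket[OF rep]
  and rho_commute = md_representation.rho_commute[OF rep]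
  and rho_diff = md_representation.rho_diff[OF rep]

lemma diff_M_closed [simp]: "u \<in> carrier M \<Longrightarrow> diff M u \<in> carrier M"
  by (rule linear_maps_closed[OF diff_M_linear])

lemma rho_closed [simp]:
  "\<lbrakk>a \<in> carrier A; b \<in> carrier A; u \<in> carrier M\<rbrakk> \<Longrightarrow> rho a b u \<in> carrier M"
  by (rule trilinear_closed[OF rho_trilinear])

lemmas diff_M_add = linear_maps_add[OF diff_M_linear]
  and diff_M_smult = linear_maps_smult[OF diff_M_linear]
  and rho_add = trilinear_add[OF rho_trilinear]
  and rho_smult = trilinear_smult[OF rho_trilinear]

lemmas diff_M_zero = linear_maps_zero[OF diff_M_linear M.abelian_group_axioms M.abelian_group_axioms]
  and rho_zero = trilinear_zero[OF rho_trilinear A.abelian_group_axioms A.abelian_group_axioms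
    M.abelian_group_axioms M.abelian_group_axioms]
  and rho_uminus = linear_maps_uminus[OF trilinearD(3)[OF rho_trilinear] M.abelian_group_axioms
    M.abelian_group_axioms]

text \<open>Moving the negative terms to the other side puts the cocycle equation into the shape of
  the fundamental identity, with one group of terms for each summand on its right. Both directions
  of the correspondence meet in this form.\<close>

lemma delta3_eq_zero_iff:
  assumes f: "trilinear K A A A M f"
    and a: "a1 \<in> carrier A" "a2 \<in> carrier A" "a3 \<in> carrier A" "a4 \<in> carrier A" "a5 \<in> carrier A"
  shows "delta3 A M rho f a1 a2 a3 a4 a5 = \<zero>\<^bsub>M\<^esub> \<longleftrightarrow>
    rho a1 a2 (f a3 a4 a5) \<oplus>\<^bsub>M\<^esub> f a1 a2 (bracket A a3 a4 a5) =
      rho a4 a5 (f a1 a2 a3) \<oplus>\<^bsub>M\<^esub> f (bracket A a1 a2 a3) a4 a5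
      \<oplus>\<^bsub>M\<^esub> (rho a5 a3 (f a1 a2 a4) \<oplus>\<^bsub>M\<^esub> f a3 (bracket A a1 a2 a4) a5)
      \<oplus>\<^bsub>M\<^esub> (rho a3 a4 (f a1 a2 a5) \<oplus>\<^bsub>M\<^esub> f a3 a4 (bracket A a1 a2 a5))"
    (is "_ \<longleftrightarrow> ?l = ?r")
proof -
  note closed = a trilinear_closed[OF f]
  have "delta3 A M rho f a1 a2 a3 a4 a5 = ?l \<ominus>\<^bsub>M\<^esub> ?r"
    using closed by (simp add: delta3_def M.minus_eq M.minus_add M.a_ac)
  moreover have "?l \<in> carrier M" "?r \<in> carrier M" using closed by simp_all
  ultimately show ?thesis by (metis M.minus_eq M.r_neg M.minus_equality M.minus_minus M.a_inv_closed)
qed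

text \<open>The same rearrangement for the compatibility of operator and bracket: the left side
  comes from the operator applied to a bracket, and the last summand on the right from the
  \<open>lam\<close> term.\<close>

lemma delta1_Phi3_eq_zero_iff:
  assumes f: "trilinear K A A A M f" and g: "g \<in> linear_maps K A M"
    and a: "a1 \<in> carrier A" "a2 \<in> carrier A" "a3 \<in> carrier A"
  shows "delta1 A M rho g a1 a2 a3 \<oplus>\<^bsub>M\<^esub> Phi3 lam A M f a1 a2 a3 = \<zero>\<^bsub>M\<^esub> \<longleftrightarrow>
    g (bracket A a1 a2 a3) \<oplus>\<^bsub>M\<^esub> diff M (f a1 a2 a3) =
      rho a2 a3 (g a1) \<oplus>\<^bsub>M\<^esub> f (diff A a1) a2 a3
      \<oplus>\<^bsub>M\<^esub> (rho a3 a1 (g a2) \<oplus>\<^bsub>M\<^esub> f a1 (diff A a2) a3)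
      \<oplus>\<^bsub>M\<^esub> (rho a1 a2 (g a3) \<oplus>\<^bsub>M\<^esub> f a1 a2 (diff A a3))
      \<oplus>\<^bsub>M\<^esub> lam \<odot>\<^bsub>M\<^esub> f a1 a2 a3"
    (is "_ \<longleftrightarrow> ?l = ?r")
proof -
  note closed = a trilinear_closed[OF f] linear_maps_closed[OF g]
  have "delta1 A M rho g a1 a2 a3 \<oplus>\<^bsub>M\<^esub> Phi3 lam A M f a1 a2 a3 = ?r \<ominus>\<^bsub>M\<^esub> ?l"
    using closed by (simp add: delta1_def Phi3_def M.minus_eq M.minus_add M.a_ac)
  moreover have "?l \<in> carrier M" "?r \<in> carrier M" using closed by simp_all
  ultimately show ?thesis by (metis M.minus_eq M.r_neg M.minus_equality M.minus_minus M.a_inv_closed)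
qed

text \<open>In an extension this is the trilinear expansion of the bracket of three elements of the
  form section value plus element of \<open>M\<close>. Skew-symmetry moves the entry from
  \<open>M\<close> to the last place, which produces the cyclic order in the \<open>rho\<close>
  terms.\<close>

definition twisted_bracket ::
  "('a \<Rightarrow> 'a \<Rightarrow> 'a \<Rightarrow> 'm) \<Rightarrow> 'a \<times> 'm \<Rightarrow> 'a \<times> 'm \<Rightarrow> 'a \<times> 'm \<Rightarrow> 'a \<times> 'm" where
  "twisted_bracket f = (\<lambda>(a, u) (b, v) (c, w).
    (bracket A a b c, rho b c u \<oplus>\<^bsub>M\<^esub> rho c a v \<oplus>\<^bsub>M\<^esub> rho a b w \<oplus>\<^bsub>M\<^esub> f a b c))"

text \<open>Each operation decodes its arguments with \<open>q\<close>, computes with pairs and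
  encodes the result, so that the algebra lives in the prescribed type \<open>'e\<close>.\<close>

definition twisted_product ::
  "('a \<times> 'm \<Rightarrow> 'e) \<Rightarrow> ('a \<Rightarrow> 'a \<Rightarrow> 'a \<Rightarrow> 'm) \<Rightarrow> ('a \<Rightarrow> 'm) \<Rightarrow> ('k, 'e) diff_3alg" where
  "twisted_product j f g = (let q = inv_into (carrier A \<times> carrier M) j in
    \<lparr>carrier = j ` (carrier A \<times> carrier M), mult = undefined, one = undefined,
     zero = j (\<zero>\<^bsub>A\<^esub>, \<zero>\<^bsub>M\<^esub>),
     add = (\<lambda>x y. j (fst (q x) \<oplus>\<^bsub>A\<^esub> fst (q y), snd (q x) \<oplus>\<^bsub>M\<^esub> snd (q y))),
     smult = (\<lambda>c x. j (c \<odot>\<^bsub>A\<^esub> fst (q x), c \<odot>\<^bsub>M\<^esub> snd (q x))),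
     bracket = (\<lambda>x y z. j (twisted_bracket f (q x) (q y) (q z))),
     diff = (\<lambda>x. j (diff A (fst (q x)), diff M (snd (q x)) \<oplus>\<^bsub>M\<^esub> g (fst (q x))))\<rparr>)"

lemma twisted_product_simps:
  assumes "inj_on j (carrier A \<times> carrier M)"
  shows "carrier (twisted_product j f g) = j ` (carrier A \<times> carrier M)"
    and "\<zero>\<^bsub>twisted_product j f g\<^esub> = j (\<zero>\<^bsub>A\<^esub>, \<zero>\<^bsub>M\<^esub>)"
    and "\<lbrakk>a \<in> carrier A; b \<in> carrier A; u \<in> carrier M; v \<in> carrier M\<rbrakk> \<Longrightarrow>
      j (a, u) \<oplus>\<^bsub>twisted_product j f g\<^esub> j (b, v) = j (a \<oplus>\<^bsub>A\<^esub> b, u \<oplus>\<^bsub>M\<^esub> v)"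
    and "\<lbrakk>a \<in> carrier A; u \<in> carrier M\<rbrakk> \<Longrightarrow>
      k \<odot>\<^bsub>twisted_product j f g\<^esub> j (a, u) = j (k \<odot>\<^bsub>A\<^esub> a, k \<odot>\<^bsub>M\<^esub> u)"
    and "\<lbrakk>a \<in> carrier A; b \<in> carrier A; c \<in> carrier A;
        u \<in> carrier M; v \<in> carrier M; w \<in> carrier M\<rbrakk> \<Longrightarrow>
      bracket (twisted_product j f g) (j (a, u)) (j (b, v)) (j (c, w)) =
        j (bracket A a b c, rho b c u \<oplus>\<^bsub>M\<^esub> rho c a v \<oplus>\<^bsub>M\<^esub> rho a b w \<oplus>\<^bsub>M\<^esub> f a b c)"
    and "\<lbrakk>a \<in> carrier A; u \<in> carrier M\<rbrakk> \<Longrightarrow>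
      diff (twisted_product j f g) (j (a, u)) = j (diff A a, diff M u \<oplus>\<^bsub>M\<^esub> g a)"
  using assms by (simp_all add: twisted_product_def twisted_bracket_def Let_def)

end

section \<open>The axioms for the product twisted by a cocycle\<close>

locale twisted = coefficient_system K A M lam rho
  for K :: "('k, 'r) ring_scheme" (structure) and A :: "('k, 'a, 's) diff_3alg_scheme"
    and M :: "('k, 'm, 't) diff_3alg_scheme" and lam rho +
  fixes j :: "'a \<times> 'm \<Rightarrow> 'e" and f :: "'a \<Rightarrow> 'a \<Rightarrow> 'a \<Rightarrow> 'm" and g :: "'a \<Rightarrow> 'm"
  assumes inj_j: "inj_on j (carrier A \<times> carrier M)" and cocycle: "(f, g) \<in> cocycles K lam A M rho"
begin

abbreviation Q where "Q \<equiv> twisted_product j f g"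

lemmas Q_simps [simp] = twisted_product_simps[OF inj_j, where f = f and g = g]

lemma f_cochain: "f \<in> cochains3 K A M" and g_cochain: "g \<in> cochains1 K A M"
  using cocycle by (auto simp: cocycles_def)

lemma f_tri: "trilinear K A A A M f" and f_skew: "skew3 A M f"
  using f_cochain by (auto simp: cochains3_def)

lemma g_linear: "g \<in> linear_maps K A M"
  using g_cochain by (auto simp: cochains1_def)

lemma f_closed [simp]: "\<lbrakk>a \<in> carrier A; b \<in> carrier A; c \<in> carrier A\<rbrakk> \<Longrightarrow> f a b c \<in> carrier M"
  by (rule trilinear_closed[OF f_tri])

lemma g_closed [simp]: "a \<in> carrier A \<Longrightarrow> g a \<in> carrier M"
  by (rule linear_maps_closed[OF g_linear])

lemma j_eq_iff [simp]:
  "\<lbrakk>a \<in> carrier A; u \<in> carrier M; b \<in> carrier A; v \<in> carrier M\<rbrakk> \<Longrightarrow> j (a, u) = j (b, v) \<longleftrightarrow> a = b \<and> u = v"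
  using inj_j by (auto simp: inj_on_def)

lemma Q_cases:
  assumes "x \<in> carrier Q"
  obtains a u where "a \<in> carrier A" "u \<in> carrier M" "x = j (a, u)"
  using assms by auto

lemma Q_module: "module K Q"
proof (rule moduleI)
  show "cring K" ..
  show "abelian_group Q"
  proof (rule abelian_groupI)
    fix x assume "x \<in> carrier Q"
    then obtain a u where x: "x = j (a, u)" "a \<in> carrier A" "u \<in> carrier M" by auto
    then show "\<exists>y \<in> carrier Q. y \<oplus>\<^bsub>Q\<^esub> x = \<zero>\<^bsub>Q\<^esub>"
      by (intro bexI[of _ "j (\<ominus>\<^bsub>A\<^esub> a, \<ominus>\<^bsub>M\<^esub> u)"]) (auto simp: A.l_neg M.l_neg)
  qed (auto simp: A.a_ac M.a_ac)
qed (auto simp: A.smult_l_distr M.smult_l_distr A.smult_r_distr M.smult_r_distr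
  A.smult_assoc1 M.smult_assoc1)

lemma Q_diff_linear: "diff Q \<in> linear_maps K Q Q"
  by (rule linear_mapsI)
    (auto simp: A.diff_add diff_M_add linear_maps_add[OF g_linear] A.diff_smult diff_M_smult
      linear_maps_smult[OF g_linear] M.a_ac M.smult_r_distr)

lemma Q_bracket_trilinear: "trilinear K Q Q Q Q (bracket Q)"
  by (intro trilinearI linear_mapsI)
    (auto simp: A.bracket_add rho_add trilinear_add[OF f_tri] A.bracket_smult rho_smult
      trilinear_smult[OF f_tri] M.a_ac M.smult_r_distr)

text \<open>Negation is no field of the record but derived from addition, so it is identified by
  uniqueness of additive inverses.\<close>

lemma Q_uminus:
  assumes "a \<in> carrier A" "u \<in> carrier M"
  shows "\<ominus>\<^bsub>Q\<^esub> j (a, u) = j (\<ominus>\<^bsub>A\<^esub> a, \<ominus>\<^bsub>M\<^esub> u)"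
proof -
  interpret Q: module K Q by (rule Q_module)
  show ?thesis
    using assms by (intro Q.M.minus_equality) (auto simp: A.l_neg M.l_neg)
qed

lemma Q_skew: "skew3 Q Q (bracket Q)"
proof -
  have f: "f b a c = \<ominus>\<^bsub>M\<^esub> f a b c" "f a c b = \<ominus>\<^bsub>M\<^esub> f a b c"
    if "a \<in> carrier A" "b \<in> carrier A" "c \<in> carrier A" for a b c
    using f_skew that unfolding skew3_def by blast+
  have swap: "bracket Q y x z = \<ominus>\<^bsub>Q\<^esub> bracket Q x y z \<and> bracket Q x z y = \<ominus>\<^bsub>Q\<^esub> bracket Q x y z"
    if xyz: "x \<in> carrier Q" "y \<in> carrier Q" "z \<in> carrier Q" for x y z
  proof -
    obtain a u b v c w where "x = j (a, u)" "y = j (b, v)" "z = j (c, w)"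
      "a \<in> carrier A" "u \<in> carrier M" "b \<in> carrier A" "v \<in> carrier M" "c \<in> carrier A" "w \<in> carrier M"
      using xyz by auto
    \<comment> \<open>After a swap of two arguments each \<open>rho\<close> term keeps its entry
      from \<open>M\<close> and has its two entries from \<open>A\<close> interchanged, so every
      summand changes sign separately.\<close>
    then show ?thesis
      by (simp add: Q_uminus A.bracket_swap[of a b c] f[of a b c] M.minus_add M.a_ac
        rho_skew[of a b] rho_skew[of b c] rho_skew[of c a])
  qed
  show ?thesis unfolding skew3_def using swap by blast
qed

text \<open>The \<open>A\<close>-coordinates agree by the identity in \<open>A\<close>. The
  \<open>M\<close>-coordinates split by the entries from \<open>M\<close>: the terms in
  \<open>u1\<close> and \<open>u2\<close> match by \<open>rho_bracket\<close>, those in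
  \<open>u3\<close>, \<open>u4\<close> and \<open>u5\<close> by \<open>rho_commute\<close>, and the
  terms without any of them by the cocycle equation for \<open>f\<close>.\<close>

lemma Q_fundamental_identity:
  assumes a: "a1 \<in> carrier A" "a2 \<in> carrier A" "a3 \<in> carrier A" "a4 \<in> carrier A" "a5 \<in> carrier A"
    and u: "u1 \<in> carrier M" "u2 \<in> carrier M" "u3 \<in> carrier M" "u4 \<in> carrier M" "u5 \<in> carrier M"
  defines "x1 \<equiv> j (a1, u1)" and "x2 \<equiv> j (a2, u2)" and "x3 \<equiv> j (a3, u3)"
    and "x4 \<equiv> j (a4, u4)" and "x5 \<equiv> j (a5, u5)"
  shows "bracket Q x1 x2 (bracket Q x3 x4 x5) =
    bracket Q (bracket Q x1 x2 x3) x4 x5 \<oplus>\<^bsub>Q\<^esub> bracket Q x3 (bracket Q x1 x2 x4) x5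
    \<oplus>\<^bsub>Q\<^esub> bracket Q x3 x4 (bracket Q x1 x2 x5)"
proof -
  \<comment> \<open>This is \<open>rho_bracket\<close> with the bracket in the second slot. The sign
    from swapping the outer arguments cancels in each summand against the sign from the inner
    \<open>rho\<close>.\<close>
  have outer: "rho b (bracket A a3 a4 a5) v =
      rho a4 a5 (rho b a3 v) \<oplus>\<^bsub>M\<^esub> rho a5 a3 (rho b a4 v) \<oplus>\<^bsub>M\<^esub> rho a3 a4 (rho b a5 v)"
    if "b \<in> carrier A" "v \<in> carrier M" for b v
    using rho_bracket[of a3 a4 a5 b v] that a
    by (simp add: rho_skew[of _ b] rho_uminus M.minus_add)
  let ?b345 = "bracket A a3 a4 a5" and ?b123 = "bracket A a1 a2 a3"
    and ?b124 = "bracket A a1 a2 a4" and ?b125 = "bracket A a1 a2 a5"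
  \<comment> \<open>These are the \<open>M\<close>-coordinates of the four terms of the identity;
    the digits in \<open>?r123\<close>, \<open>?r124\<close> and \<open>?r125\<close> name the
    arguments of the inner bracket.\<close>
  let ?l = "rho a2 ?b345 u1 \<oplus>\<^bsub>M\<^esub> rho ?b345 a1 u2
    \<oplus>\<^bsub>M\<^esub> rho a1 a2 (rho a4 a5 u3 \<oplus>\<^bsub>M\<^esub> rho a5 a3 u4 \<oplus>\<^bsub>M\<^esub> rho a3 a4 u5 \<oplus>\<^bsub>M\<^esub> f a3 a4 a5) \<oplus>\<^bsub>M\<^esub> f a1 a2 ?b345"
  let ?r123 = "rho a4 a5 (rho a2 a3 u1 \<oplus>\<^bsub>M\<^esub> rho a3 a1 u2 \<oplus>\<^bsub>M\<^esub> rho a1 a2 u3 \<oplus>\<^bsub>M\<^esub> f a1 a2 a3)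
    \<oplus>\<^bsub>M\<^esub> rho a5 ?b123 u4 \<oplus>\<^bsub>M\<^esub> rho ?b123 a4 u5 \<oplus>\<^bsub>M\<^esub> f ?b123 a4 a5"
  let ?r124 = "rho ?b124 a5 u3 \<oplus>\<^bsub>M\<^esub> rho a5 a3 (rho a2 a4 u1 \<oplus>\<^bsub>M\<^esub> rho a4 a1 u2 \<oplus>\<^bsub>M\<^esub> rho a1 a2 u4 \<oplus>\<^bsub>M\<^esub> f a1 a2 a4)
    \<oplus>\<^bsub>M\<^esub> rho a3 ?b124 u5 \<oplus>\<^bsub>M\<^esub> f a3 ?b124 a5"
  let ?r125 = "rho a4 ?b125 u3 \<oplus>\<^bsub>M\<^esub> rho ?b125 a3 u4
    \<oplus>\<^bsub>M\<^esub> rho a3 a4 (rho a2 a5 u1 \<oplus>\<^bsub>M\<^esub> rho a5 a1 u2 \<oplus>\<^bsub>M\<^esub> rho a1 a2 u5 \<oplus>\<^bsub>M\<^esub> f a1 a2 a5) \<oplus>\<^bsub>M\<^esub> f a3 a4 ?b125"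
  have "delta3 A M rho f a1 a2 a3 a4 a5 = \<zero>\<^bsub>M\<^esub>"
    using cocycle a by (auto simp: cocycles_def)
  then have f: "rho a1 a2 (f a3 a4 a5) \<oplus>\<^bsub>M\<^esub> f a1 a2 ?b345 =
      rho a4 a5 (f a1 a2 a3) \<oplus>\<^bsub>M\<^esub> f ?b123 a4 a5 \<oplus>\<^bsub>M\<^esub> (rho a5 a3 (f a1 a2 a4) \<oplus>\<^bsub>M\<^esub> f a3 ?b124 a5)
      \<oplus>\<^bsub>M\<^esub> (rho a3 a4 (f a1 a2 a5) \<oplus>\<^bsub>M\<^esub> f a3 a4 ?b125)"
    using delta3_eq_zero_iff[OF f_tri a] by simp
  have "?l = rho a2 ?b345 u1 \<oplus>\<^bsub>M\<^esub> rho ?b345 a1 u2 \<oplus>\<^bsub>M\<^esub> rho a1 a2 (rho a4 a5 u3)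
      \<oplus>\<^bsub>M\<^esub> rho a1 a2 (rho a5 a3 u4) \<oplus>\<^bsub>M\<^esub> rho a1 a2 (rho a3 a4 u5)
      \<oplus>\<^bsub>M\<^esub> (rho a1 a2 (f a3 a4 a5) \<oplus>\<^bsub>M\<^esub> f a1 a2 ?b345)"
    using a u by (simp add: rho_add M.a_assoc)
  also have "\<dots> = ?r123 \<oplus>\<^bsub>M\<^esub> ?r124 \<oplus>\<^bsub>M\<^esub> ?r125"
    unfolding f outer[OF a(2) u(1)] rho_bracket[OF a(3-5) a(1) u(2)] rho_commute[OF a(1,2,4,5) u(3)]
      rho_commute[OF a(1,2,5,3) u(4)] rho_commute[OF a(1,2,3,4) u(5)]
    using a u by (simp add: rho_add M.a_ac)
  finally show ?thesis
    using a u by (simp add: assms(11-) A.fundamental_identity[OF a])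
qed

text \<open>Again the \<open>M\<close>-coordinate splits: the terms in \<open>u1\<close>,
  \<open>u2\<close> and \<open>u3\<close> are the three cyclic instances of \<open>rho_diff\<close>,
  and the remainder is the second cocycle equation, which couples \<open>f\<close> and
  \<open>g\<close>.\<close>

lemma Q_diff_bracket:
  assumes a: "a1 \<in> carrier A" "a2 \<in> carrier A" "a3 \<in> carrier A"
    and u: "u1 \<in> carrier M" "u2 \<in> carrier M" "u3 \<in> carrier M"
  defines "x1 \<equiv> j (a1, u1)" and "x2 \<equiv> j (a2, u2)" and "x3 \<equiv> j (a3, u3)"
  shows "diff Q (bracket Q x1 x2 x3) =
    bracket Q (diff Q x1) x2 x3 \<oplus>\<^bsub>Q\<^esub> bracket Q x1 (diff Q x2) x3 \<oplus>\<^bsub>Q\<^esub> bracket Q x1 x2 (diff Q x3)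
    \<oplus>\<^bsub>Q\<^esub> lam \<odot>\<^bsub>Q\<^esub> bracket Q x1 x2 x3"
proof -
  have "delta1 A M rho g a1 a2 a3 \<oplus>\<^bsub>M\<^esub> Phi3 lam A M f a1 a2 a3 = \<zero>\<^bsub>M\<^esub>"
    using cocycle a by (auto simp: cocycles_def)
  note fg = delta1_Phi3_eq_zero_iff[OF f_tri g_linear a, THEN iffD1, OF this]
  let ?l = "diff M (rho a2 a3 u1 \<oplus>\<^bsub>M\<^esub> rho a3 a1 u2 \<oplus>\<^bsub>M\<^esub> rho a1 a2 u3 \<oplus>\<^bsub>M\<^esub> f a1 a2 a3)
    \<oplus>\<^bsub>M\<^esub> g (bracket A a1 a2 a3)"
  let ?r1 = "rho a2 a3 (diff M u1 \<oplus>\<^bsub>M\<^esub> g a1) \<oplus>\<^bsub>M\<^esub> rho a3 (diff A a1) u2 \<oplus>\<^bsub>M\<^esub> rho (diff A a1) a2 u3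
    \<oplus>\<^bsub>M\<^esub> f (diff A a1) a2 a3"
  let ?r2 = "rho (diff A a2) a3 u1 \<oplus>\<^bsub>M\<^esub> rho a3 a1 (diff M u2 \<oplus>\<^bsub>M\<^esub> g a2) \<oplus>\<^bsub>M\<^esub> rho a1 (diff A a2) u3
    \<oplus>\<^bsub>M\<^esub> f a1 (diff A a2) a3"
  let ?r3 = "rho a2 (diff A a3) u1 \<oplus>\<^bsub>M\<^esub> rho (diff A a3) a1 u2 \<oplus>\<^bsub>M\<^esub> rho a1 a2 (diff M u3 \<oplus>\<^bsub>M\<^esub> g a3)
    \<oplus>\<^bsub>M\<^esub> f a1 a2 (diff A a3)"
  let ?r4 = "lam \<odot>\<^bsub>M\<^esub> (rho a2 a3 u1 \<oplus>\<^bsub>M\<^esub> rho a3 a1 u2 \<oplus>\<^bsub>M\<^esub> rho a1 a2 u3 \<oplus>\<^bsub>M\<^esub> f a1 a2 a3)"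
  have "?l = diff M (rho a2 a3 u1) \<oplus>\<^bsub>M\<^esub> diff M (rho a3 a1 u2) \<oplus>\<^bsub>M\<^esub> diff M (rho a1 a2 u3)
      \<oplus>\<^bsub>M\<^esub> (g (bracket A a1 a2 a3) \<oplus>\<^bsub>M\<^esub> diff M (f a1 a2 a3))"
    using a u by (simp add: diff_M_add M.a_ac)
  also have "\<dots> = ?r1 \<oplus>\<^bsub>M\<^esub> ?r2 \<oplus>\<^bsub>M\<^esub> ?r3 \<oplus>\<^bsub>M\<^esub> ?r4"
    unfolding fg rho_diff[OF a(2,3) u(1)] rho_diff[OF a(3,1) u(2)] rho_diff[OF a(1,2) u(3)]
    using a u by (simp add: rho_add M.smult_r_distr M.a_ac)
  finally show ?thesis
    using a u by (simp add: assms(7-) A.diff_bracket[OF a])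
qed

lemma Q_md_3lie_algebra: "md_3lie_algebra K lam Q"
proof -
  interpret Q: module K Q by (rule Q_module)
  show ?thesis
  proof unfold_locales
    show "trilinear K Q Q Q Q (bracket Q)" by (rule Q_bracket_trilinear)
    show "skew3 Q Q (bracket Q)" by (rule Q_skew)
    show "diff Q \<in> linear_maps K Q Q" by (rule Q_diff_linear)
  next
    fix x1 x2 x3 x4 x5
    assume "x1 \<in> carrier Q" "x2 \<in> carrier Q" "x3 \<in> carrier Q" "x4 \<in> carrier Q" "x5 \<in> carrier Q"
    then show "bracket Q x1 x2 (bracket Q x3 x4 x5) =
      bracket Q (bracket Q x1 x2 x3) x4 x5 \<oplus>\<^bsub>Q\<^esub> bracket Q x3 (bracket Q x1 x2 x4) x5
      \<oplus>\<^bsub>Q\<^esub> bracket Q x3 x4 (bracket Q x1 x2 x5)"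
      by (elim Q_cases) (hypsubst, rule Q_fundamental_identity)
  next
    fix x1 x2 x3 assume "x1 \<in> carrier Q" "x2 \<in> carrier Q" "x3 \<in> carrier Q"
    then show "diff Q (bracket Q x1 x2 x3) =
      bracket Q (diff Q x1) x2 x3 \<oplus>\<^bsub>Q\<^esub> bracket Q x1 (diff Q x2) x3 \<oplus>\<^bsub>Q\<^esub> bracket Q x1 x2 (diff Q x3)
      \<oplus>\<^bsub>Q\<^esub> lam \<odot>\<^bsub>Q\<^esub> bracket Q x1 x2 x3"
      by (elim Q_cases) (hypsubst, rule Q_diff_bracket)
  qed
qed

end

section \<open>Cosets of coboundaries\<close>

context coefficient_system
begin

text \<open>A name for the coboundary of a single cochain makes a coset the orbit of a cocycle under
  \<open>cochains1\<close>. The laws of this action are \<open>coboundary_add\<close> and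
  \<open>coboundary_zero\<close>, and cosets are compared through them.\<close>

definition coboundary :: "('a \<Rightarrow> 'm) \<Rightarrow> ('a \<Rightarrow> 'a \<Rightarrow> 'a \<Rightarrow> 'm) \<times> ('a \<Rightarrow> 'm)" where
  "coboundary h = (\<lambda>a\<in>carrier A. \<lambda>b\<in>carrier A. \<lambda>c\<in>carrier A. delta1 A M rho h a b c,
    \<lambda>a\<in>carrier A. \<ominus>\<^bsub>M\<^esub> Phi1 A M h a)"

abbreviation Z where "Z \<equiv> cocycle_group K lam A M rho"
abbreviation B where "B \<equiv> coboundaries K A M rho"

lemma coset_eq: "B #>\<^bsub>Z\<^esub> c = (\<lambda>h. coboundary h \<otimes>\<^bsub>Z\<^esub> c) ` cochains1 K A M"
  by (auto simp: r_coset_def coboundaries_def coboundary_def)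

lemma coboundary_mult:
  "coboundary h \<otimes>\<^bsub>Z\<^esub> (f, g) =
    (\<lambda>a\<in>carrier A. \<lambda>b\<in>carrier A. \<lambda>c\<in>carrier A. delta1 A M rho h a b c \<oplus>\<^bsub>M\<^esub> f a b c,
     \<lambda>a\<in>carrier A. \<ominus>\<^bsub>M\<^esub> Phi1 A M h a \<oplus>\<^bsub>M\<^esub> g a)"
  by (auto simp: cocycle_group_def coboundary_def fun_eq_iff)

lemma cochains1_linear: "h \<in> cochains1 K A M \<Longrightarrow> h \<in> linear_maps K A M"
  by (simp add: cochains1_def)

lemma cochains1_closed: "\<lbrakk>h \<in> cochains1 K A M; a \<in> carrier A\<rbrakk> \<Longrightarrow> h a \<in> carrier M"
  by (rule linear_maps_closed[OF cochains1_linear])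

lemma restrict_cochains1:
  assumes "h \<in> linear_maps K A M"
  shows "restrict h (carrier A) \<in> cochains1 K A M"
proof -
  have "restrict h (carrier A) \<in> linear_maps K A M"
    using assms by (intro linear_mapsI)
      (auto simp: linear_maps_closed linear_maps_add linear_maps_smult)
  then show ?thesis using assms by (auto simp: cochains1_def linear_maps_closed)
qed

lemma
  assumes "h \<in> linear_maps K A M" "a \<in> carrier A"
  shows delta1_closed:
      "\<lbrakk>b \<in> carrier A; c \<in> carrier A\<rbrakk> \<Longrightarrow> delta1 A M rho h a b c \<in> carrier M"
    and Phi1_closed: "Phi1 A M h a \<in> carrier M"
  using assms by (auto simp: delta1_def Phi1_def linear_maps_closed)

text \<open>\<open>delta1\<close> and \<open>Phi1\<close> are additive in the cochain because
  \<open>rho\<close> and \<open>diff M\<close> are additive, so successive shifts of a cocycle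
  combine into one.\<close>

lemma coboundary_add:
  assumes h: "h \<in> cochains1 K A M" "h' \<in> cochains1 K A M" and c: "c \<in> cocycles K lam A M rho"
  shows "coboundary h \<otimes>\<^bsub>Z\<^esub> (coboundary h' \<otimes>\<^bsub>Z\<^esub> c) =
    coboundary (\<lambda>a\<in>carrier A. h a \<oplus>\<^bsub>M\<^esub> h' a) \<otimes>\<^bsub>Z\<^esub> c"
proof -
  obtain f g where fg: "c = (f, g)" by (cases c)
  have f: "f a1 a2 a3 \<in> carrier M" if "a1 \<in> carrier A" "a2 \<in> carrier A" "a3 \<in> carrier A" for a1 a2 a3
    using c that trilinear_closed[of K A A A M f] by (auto simp: fg cocycles_def cochains3_def)
  have g: "g a \<in> carrier M" if "a \<in> carrier A" for a
    using c that cochains1_closed[of g] by (auto simp: fg cocycles_def)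
  note closed = cochains1_closed[OF h(1)] cochains1_closed[OF h(2)]
  have d: "delta1 A M rho (\<lambda>a\<in>carrier A. h a \<oplus>\<^bsub>M\<^esub> h' a) a1 a2 a3 =
      delta1 A M rho h a1 a2 a3 \<oplus>\<^bsub>M\<^esub> delta1 A M rho h' a1 a2 a3"
    if "a1 \<in> carrier A" "a2 \<in> carrier A" "a3 \<in> carrier A" for a1 a2 a3
    using that by (simp add: delta1_def closed rho_add M.minus_eq M.minus_add M.a_ac)
  have p: "Phi1 A M (\<lambda>a\<in>carrier A. h a \<oplus>\<^bsub>M\<^esub> h' a) a = Phi1 A M h a \<oplus>\<^bsub>M\<^esub> Phi1 A M h' a"
    if "a \<in> carrier A" for a
    using that by (simp add: Phi1_def closed diff_M_add M.minus_eq M.minus_add M.a_ac)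
  show ?thesis
    unfolding fg coboundary_mult prod.inject
    by (intro conjI restrict_ext)
      (simp_all add: d p f g delta1_closed Phi1_closed cochains1_linear[OF h(1)] cochains1_linear[OF h(2)]
        M.a_assoc M.minus_add)
qed

lemma cochains1_restrict: "g \<in> cochains1 K A M \<Longrightarrow> (\<lambda>a\<in>carrier A. g a) = g"
  by (auto simp: cochains1_def intro: PiE_restrict)

text \<open>A cochain is extensional in each of its three arguments, so the nested restrictions can
  be removed one at a time, starting with the innermost.\<close>

lemma cochains3_restrict:
  assumes "f \<in> cochains3 K A M"
  shows "(\<lambda>a\<in>carrier A. \<lambda>b\<in>carrier A. \<lambda>c\<in>carrier A. f a b c) = f"
proof -
  have f: "f \<in> carrier A \<rightarrow>\<^sub>E carrier A \<rightarrow>\<^sub>E carrier A \<rightarrow>\<^sub>E carrier M"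
    using assms by (simp add: cochains3_def)
  have "(\<lambda>a\<in>carrier A. \<lambda>b\<in>carrier A. \<lambda>c\<in>carrier A. f a b c) =
      (\<lambda>a\<in>carrier A. \<lambda>b\<in>carrier A. f a b)"
    using PiE_restrict[OF PiE_mem[OF PiE_mem[OF f]]] by (intro restrict_ext) simp
  also have "\<dots> = restrict f (carrier A)"
    using PiE_restrict[OF PiE_mem[OF f]] by (intro restrict_ext) simp
  also have "\<dots> = f" by (rule PiE_restrict[OF f])
  finally show ?thesis .
qed

lemma coboundary_zero:
  assumes c: "c \<in> cocycles K lam A M rho"
  shows "coboundary (\<lambda>a\<in>carrier A. \<zero>\<^bsub>M\<^esub>) \<otimes>\<^bsub>Z\<^esub> c = c"
proof -
  obtain f g where fg: "c = (f, g)" by (cases c)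
  have f: "f \<in> carrier A \<rightarrow>\<^sub>E carrier A \<rightarrow>\<^sub>E carrier A \<rightarrow>\<^sub>E carrier M"
    and g: "g \<in> carrier A \<rightarrow>\<^sub>E carrier M"
    using c by (auto simp: fg cocycles_def cochains3_def cochains1_def)
  have d: "delta1 A M rho (\<lambda>a\<in>carrier A. \<zero>\<^bsub>M\<^esub>) a1 a2 a3 = \<zero>\<^bsub>M\<^esub>"
    if "a1 \<in> carrier A" "a2 \<in> carrier A" "a3 \<in> carrier A" for a1 a2 a3
    using that by (simp add: delta1_def rho_zero M.minus_eq)
  have p: "Phi1 A M (\<lambda>a\<in>carrier A. \<zero>\<^bsub>M\<^esub>) a = \<zero>\<^bsub>M\<^esub>" if "a \<in> carrier A" for a
    using that by (simp add: Phi1_def diff_M_zero M.minus_eq)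
  have "coboundary (\<lambda>a\<in>carrier A. \<zero>\<^bsub>M\<^esub>) \<otimes>\<^bsub>Z\<^esub> c =
      (\<lambda>a1\<in>carrier A. \<lambda>a2\<in>carrier A. \<lambda>a3\<in>carrier A. f a1 a2 a3, restrict g (carrier A))"
    unfolding fg coboundary_mult prod.inject
    using PiE_mem[OF PiE_mem[OF PiE_mem[OF f]]] PiE_mem[OF g]
    by (intro conjI restrict_ext) (simp_all add: d p)
  then show ?thesis
    using c by (simp add: fg cocycles_def cochains3_restrict cochains1_restrict)
qed

lemma zero_cochain: "(\<lambda>a\<in>carrier A. \<zero>\<^bsub>M\<^esub>) \<in> cochains1 K A M"
  by (rule restrict_cochains1) (auto intro: linear_mapsI)

text \<open>A shift by \<open>h\<close> only reparametrises the orbit: \<open>h'\<close> is replaced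
  by the sum of \<open>h'\<close> and \<open>h\<close> in one direction and by their difference in
  the other.\<close>

lemma coset_coboundary_mult:
  assumes h: "h \<in> cochains1 K A M" and c: "c \<in> cocycles K lam A M rho"
  shows "B #>\<^bsub>Z\<^esub> (coboundary h \<otimes>\<^bsub>Z\<^esub> c) = B #>\<^bsub>Z\<^esub> c"
proof
  have add: "(\<lambda>a\<in>carrier A. h' a \<oplus>\<^bsub>M\<^esub> h a) \<in> cochains1 K A M" if "h' \<in> cochains1 K A M" for h'
    by (intro restrict_cochains1 linear_maps_plus cochains1_linear h that
      A.module_axioms M.module_axioms)
  then show "B #>\<^bsub>Z\<^esub> (coboundary h \<otimes>\<^bsub>Z\<^esub> c) \<subseteq> B #>\<^bsub>Z\<^esub> c"
    unfolding coset_eq using coboundary_add[OF _ h c] by (intro image_subsetI) (simp add: image_eqI)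
next
  show "B #>\<^bsub>Z\<^esub> c \<subseteq> B #>\<^bsub>Z\<^esub> (coboundary h \<otimes>\<^bsub>Z\<^esub> c)"
    unfolding coset_eq
  proof (rule image_subsetI)
    fix h' assume h': "h' \<in> cochains1 K A M"
    \<comment> \<open>Subtracting \<open>h\<close> compensates for the shift that is already
      contained in the representative.\<close>
    let ?d = "\<lambda>a\<in>carrier A. h' a \<ominus>\<^bsub>M\<^esub> h a"
    have d: "?d \<in> cochains1 K A M"
      by (intro restrict_cochains1 linear_maps_diff cochains1_linear h h'
        A.module_axioms M.module_axioms)
    have "(\<lambda>a\<in>carrier A. ?d a \<oplus>\<^bsub>M\<^esub> h a) = h'"
      using h' cochains1_closed[OF h'] cochains1_closed[OF h]
      by (intro extensionalityI[of _ "carrier A"])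
        (auto simp: M.minus_eq M.a_assoc M.l_neg cochains1_def PiE_iff)
    then have "coboundary h' \<otimes>\<^bsub>Z\<^esub> c = coboundary ?d \<otimes>\<^bsub>Z\<^esub> (coboundary h \<otimes>\<^bsub>Z\<^esub> c)"
      using coboundary_add[OF d h c] by simp
    then show "coboundary h' \<otimes>\<^bsub>Z\<^esub> c \<in> (\<lambda>h'. coboundary h' \<otimes>\<^bsub>Z\<^esub> (coboundary h \<otimes>\<^bsub>Z\<^esub> c)) ` cochains1 K A M"
      using d by blast
  qed
qed

text \<open>The zero cochain shows that \<open>c\<close> lies in its own coset, hence in that of
  \<open>c'\<close>, whose elements are by \<open>coset_eq\<close> the shifts of
  \<open>c'\<close>.\<close>

lemma coset_eqD:
  assumes "c \<in> cocycles K lam A M rho" "B #>\<^bsub>Z\<^esub> c = B #>\<^bsub>Z\<^esub> c'"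
  obtains h where "h \<in> cochains1 K A M" "c = coboundary h \<otimes>\<^bsub>Z\<^esub> c'"
proof -
  have "c \<in> B #>\<^bsub>Z\<^esub> c"
    unfolding coset_eq
    by (rule image_eqI[where x = "\<lambda>a\<in>carrier A. \<zero>\<^bsub>M\<^esub>"])
      (simp_all only: coboundary_zero[OF assms(1)] zero_cochain)
  then have "c \<in> (\<lambda>h. coboundary h \<otimes>\<^bsub>Z\<^esub> c') ` cochains1 K A M"
    unfolding assms(2) unfolding coset_eq .
  then show ?thesis by (rule imageE) (rule that)
qed

lemma carrier_H2: "carrier (H2 K lam A M rho) = (\<lambda>c. B #>\<^bsub>Z\<^esub> c) ` cocycles K lam A M rho"
  by (auto simp: H2_def FactGroup_def RCOSETS_def cocycle_group_def)

end

section \<open>Extensions and their sections\<close>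

lemma (in abelian_group) add_minus_cancel: "\<lbrakk>x \<in> carrier G; y \<in> carrier G\<rbrakk> \<Longrightarrow> y \<oplus> (x \<ominus> y) = x"
  by (simp add: minus_eq a_lcomm r_neg)

locale extension = coefficient_system K A M lam rho
  for K :: "('k, 'r) ring_scheme" (structure) and A :: "('k, 'a, 's) diff_3alg_scheme"
    and M :: "('k, 'm, 't) diff_3alg_scheme" and lam rho +
  fixes E :: "('k, 'e) diff_3alg" and i :: "'m \<Rightarrow> 'e" and p :: "'e \<Rightarrow> 'a"
  assumes extension: "(E, i, p) \<in> extensions K lam A M rho"
begin

lemma abelian_extension: "abelian_extension K lam A M (E, i, p)"
  using extension by (simp add: extensions_def)

sublocale E: md_3lie_algebra K lam E
  using abelian_extension by (simp add: abelian_extension_def)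

lemma i_hom: "i \<in> md_hom K M E" and p_hom: "p \<in> md_hom K E A"
  and i_inj: "inj_on i (carrier M)" and i_image: "i ` carrier M = a_kernel E A p"
  and p_image: "p ` carrier E = carrier A"
  using abelian_extension by (simp_all add: abelian_extension_def)

lemma i_linear: "i \<in> linear_maps K M E" and p_linear: "p \<in> linear_maps K E A"
  using i_hom p_hom by (simp_all add: md_hom_def)

lemma i_closed [simp]: "u \<in> carrier M \<Longrightarrow> i u \<in> carrier E"
  and p_closed [simp]: "x \<in> carrier E \<Longrightarrow> p x \<in> carrier A"
  using linear_maps_closed[OF i_linear] linear_maps_closed[OF p_linear] by auto

lemmas i_add = linear_maps_add[OF i_linear]
  and i_smult = linear_maps_smult[OF i_linear]
  and i_uminus = linear_maps_uminus[OF i_linear M.abelian_group_axioms E.abelian_group_axioms]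
  and p_add = linear_maps_add[OF p_linear]
  and p_minus = linear_maps_minus[OF p_linear E.abelian_group_axioms A.abelian_group_axioms]

lemma i_eq_iff [simp]: "\<lbrakk>u \<in> carrier M; v \<in> carrier M\<rbrakk> \<Longrightarrow> i u = i v \<longleftrightarrow> u = v"
  using i_inj by (auto simp: inj_on_def)

lemma diff_i: "u \<in> carrier M \<Longrightarrow> diff E (i u) = i (diff M u)"
  using i_hom by (simp add: md_hom_def)

lemma p_diff: "x \<in> carrier E \<Longrightarrow> p (diff E x) = diff A (p x)"
  using p_hom by (simp add: md_hom_def)

lemma p_bracket:
  "\<lbrakk>x \<in> carrier E; y \<in> carrier E; z \<in> carrier E\<rbrakk> \<Longrightarrow> p (bracket E x y z) = bracket A (p x) (p y) (p z)"
  using p_hom by (simp add: md_hom_def)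

lemma p_i: "u \<in> carrier M \<Longrightarrow> p (i u) = \<zero>\<^bsub>A\<^esub>"
  using i_image by (auto simp: a_kernel_def')

text \<open>Exactness at the middle term makes \<open>inv_into\<close> a true preimage under
  \<open>i\<close> on the kernel of \<open>p\<close>. All maps into \<open>M\<close> that are
  extracted from an extension rest on this.\<close>

lemma kernel_i: "\<lbrakk>x \<in> carrier E; p x = \<zero>\<^bsub>A\<^esub>\<rbrakk> \<Longrightarrow> i (inv_into (carrier M) i x) = x"
  "\<lbrakk>x \<in> carrier E; p x = \<zero>\<^bsub>A\<^esub>\<rbrakk> \<Longrightarrow> inv_into (carrier M) i x \<in> carrier M"
  using i_image by (auto simp: a_kernel_def' intro!: f_inv_into_f inv_into_into)

text \<open>The definition of an abelian extension puts the two entries from \<open>M\<close> last;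
  transpositions bring them to the other places, and the sign does not affect zero.\<close>

lemma bracket_two_i:
  assumes "x \<in> carrier E" "u \<in> carrier M" "v \<in> carrier M"
  shows "bracket E x (i u) (i v) = \<zero>\<^bsub>E\<^esub>" "bracket E (i u) x (i v) = \<zero>\<^bsub>E\<^esub>"
    "bracket E (i u) (i v) x = \<zero>\<^bsub>E\<^esub>"
proof -
  show 1: "bracket E x (i u) (i v) = \<zero>\<^bsub>E\<^esub>"
    using abelian_extension assms by (simp add: abelian_extension_def)
  show 2: "bracket E (i u) x (i v) = \<zero>\<^bsub>E\<^esub>"
    using E.bracket_swap(1)[of x "i u" "i v"] assms 1 by simp
  show "bracket E (i u) (i v) x = \<zero>\<^bsub>E\<^esub>"
    using E.bracket_swap(2)[of "i u" x "i v"] assms 2 by simp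
qed

lemma section_exists: "\<exists>s. s \<in> sections K A (E, i, p)"
  using linear_section_exists[OF K.field_axioms E.module_axioms A.module_axioms p_linear p_image]
  by (auto simp: sections_def)

end

section \<open>Coordinates along a fixed section\<close>

locale extension_section = extension K A M lam rho E i p
  for K :: "('k, 'r) ring_scheme" (structure) and A :: "('k, 'a, 's) diff_3alg_scheme"
    and M :: "('k, 'm, 't) diff_3alg_scheme" and lam rho and E :: "('k, 'e) diff_3alg" and i p +
  fixes s :: "'a \<Rightarrow> 'e"
  assumes s: "s \<in> sections K A (E, i, p)"
begin

definition f where "f = fst (section_cocycle A M (E, i, p) s)"
definition g where "g = snd (section_cocycle A M (E, i, p) s)"

lemma s_linear: "s \<in> linear_maps K A E" and p_s [simp]: "a \<in> carrier A \<Longrightarrow> p (s a) = a"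
  using s by (auto simp: sections_def)

lemma s_closed [simp]: "a \<in> carrier A \<Longrightarrow> s a \<in> carrier E"
  by (rule linear_maps_closed[OF s_linear])

lemmas s_add = linear_maps_add[OF s_linear]
  and s_smult = linear_maps_smult[OF s_linear]
  and s_zero = linear_maps_zero[OF s_linear A.abelian_group_axioms E.abelian_group_axioms]

text \<open>Subtracting \<open>s (p x)\<close> from \<open>x\<close> gives an element of the kernel
  of \<open>p\<close>, which comes from \<open>M\<close>.\<close>

lemma decompose:
  assumes "x \<in> carrier E"
  obtains a u where "a \<in> carrier A" "u \<in> carrier M" "x = s a \<oplus>\<^bsub>E\<^esub> i u"
proof
  let ?y = "x \<ominus>\<^bsub>E\<^esub> s (p x)"
  have y: "?y \<in> carrier E" "p ?y = \<zero>\<^bsub>A\<^esub>"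
    using assms by (simp_all add: p_minus A.minus_eq A.r_neg)
  show "p x \<in> carrier A" "inv_into (carrier M) i ?y \<in> carrier M"
    using assms kernel_i[OF y] by simp_all
  show "x = s (p x) \<oplus>\<^bsub>E\<^esub> i (inv_into (carrier M) i ?y)"
    using assms kernel_i[OF y] by (simp add: E.add_minus_cancel)
qed

lemma p_decomposed: "\<lbrakk>a \<in> carrier A; u \<in> carrier M\<rbrakk> \<Longrightarrow> p (s a \<oplus>\<^bsub>E\<^esub> i u) = a"
  by (simp add: p_add p_i)

text \<open>Applying \<open>p\<close> recovers the first coordinate; cancellation and injectivity of
  \<open>i\<close> recover the second.\<close>

lemma decomposition_unique:
  assumes "a \<in> carrier A" "b \<in> carrier A" "u \<in> carrier M" "v \<in> carrier M"
    and eq: "s a \<oplus>\<^bsub>E\<^esub> i u = s b \<oplus>\<^bsub>E\<^esub> i v"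
  shows "a = b \<and> u = v"
proof -
  have "a = b" using p_decomposed assms by metis
  moreover from this have "i u = i v" using assms by simp
  ultimately show ?thesis using assms by simp
qed

text \<open>Since \<open>p\<close> preserves the bracket and inverts \<open>s\<close>, the bracket
  of section values and the section of the bracket have the same image under \<open>p\<close>; their
  difference is therefore in the range of \<open>i\<close>.\<close>

lemma
  assumes "a \<in> carrier A" "b \<in> carrier A" "c \<in> carrier A"
  shows f_closed [simp]: "f a b c \<in> carrier M"
    and bracket_s: "bracket E (s a) (s b) (s c) = s (bracket A a b c) \<oplus>\<^bsub>E\<^esub> i (f a b c)"
proof -
  let ?y = "bracket E (s a) (s b) (s c) \<ominus>\<^bsub>E\<^esub> s (bracket A a b c)"
  have y: "?y \<in> carrier E" "p ?y = \<zero>\<^bsub>A\<^esub>"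
    using assms by (simp_all add: p_minus p_bracket A.minus_eq A.r_neg)
  have f: "f a b c = inv_into (carrier M) i ?y"
    using assms by (simp add: f_def section_cocycle_def)
  show "f a b c \<in> carrier M" using kernel_i[OF y] f by simp
  show "bracket E (s a) (s b) (s c) = s (bracket A a b c) \<oplus>\<^bsub>E\<^esub> i (f a b c)"
    using assms kernel_i[OF y] f by (simp add: E.add_minus_cancel)
qed

lemma
  assumes "a \<in> carrier A"
  shows g_closed [simp]: "g a \<in> carrier M"
    and diff_s: "diff E (s a) = s (diff A a) \<oplus>\<^bsub>E\<^esub> i (g a)"
proof -
  let ?y = "diff E (s a) \<ominus>\<^bsub>E\<^esub> s (diff A a)"
  have y: "?y \<in> carrier E" "p ?y = \<zero>\<^bsub>A\<^esub>"
    using assms by (simp_all add: p_minus p_diff A.minus_eq A.r_neg)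
  have g: "g a = inv_into (carrier M) i ?y"
    using assms by (simp add: g_def section_cocycle_def)
  show "g a \<in> carrier M" using kernel_i[OF y] g by simp
  show "diff E (s a) = s (diff A a) \<oplus>\<^bsub>E\<^esub> i (g a)"
    using assms kernel_i[OF y] g by (simp add: E.add_minus_cancel)
qed

text \<open>Uniqueness of coordinates: any pair satisfying the equations \<open>bracket_s\<close>
  and \<open>diff_s\<close> must be the section cocycle. The cocycles of shifted, transported and
  canonical sections are computed this way, without evaluating \<open>inv_into\<close>.\<close>

lemma section_cocycle_eqI:
  assumes "\<And>a b c. \<lbrakk>a \<in> carrier A; b \<in> carrier A; c \<in> carrier A\<rbrakk> \<Longrightarrow> f' a b c \<in> carrier M \<and>
      bracket E (s a) (s b) (s c) = s (bracket A a b c) \<oplus>\<^bsub>E\<^esub> i (f' a b c)"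
    and "\<And>a. a \<in> carrier A \<Longrightarrow> g' a \<in> carrier M \<and> diff E (s a) = s (diff A a) \<oplus>\<^bsub>E\<^esub> i (g' a)"
  shows "section_cocycle A M (E, i, p) s =
    (\<lambda>a\<in>carrier A. \<lambda>b\<in>carrier A. \<lambda>c\<in>carrier A. f' a b c, \<lambda>a\<in>carrier A. g' a)"
proof -
  have "f a b c = f' a b c" if "a \<in> carrier A" "b \<in> carrier A" "c \<in> carrier A" for a b c
    using assms(1)[OF that] that
    by (intro conjunct2[OF decomposition_unique[of "bracket A a b c" "bracket A a b c"]])
      (simp_all flip: bracket_s)
  moreover have "g a = g' a" if "a \<in> carrier A" for a
    using assms(2)[OF that] that
    by (intro conjunct2[OF decomposition_unique[of "diff A a" "diff A a"]]) (simp_all flip: diff_s)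
  moreover have "section_cocycle A M (E, i, p) s =
      (\<lambda>a\<in>carrier A. \<lambda>b\<in>carrier A. \<lambda>c\<in>carrier A. f a b c, \<lambda>a\<in>carrier A. g a)"
    unfolding f_def g_def section_cocycle_def by (simp cong: restrict_cong)
  ultimately show ?thesis by (simp cong: restrict_cong)
qed

text \<open>The induced representation describes the entry from \<open>M\<close> in the last place.
  One transposition moves it to the middle, where \<open>rho_skew\<close> absorbs the sign by
  reversing \<open>a\<close> and \<open>b\<close>; a second one moves it to the front and restores
  their order.\<close>

lemma
  assumes "a \<in> carrier A" "b \<in> carrier A" "u \<in> carrier M"
  shows bracket_i: "bracket E (s a) (s b) (i u) = i (rho a b u)"
      "bracket E (s a) (i u) (s b) = i (rho b a u)"
      "bracket E (i u) (s a) (s b) = i (rho a b u)"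
proof -
  have rho: "bracket E (s a) (s b) (i u) = i (rho a b u)"
    if "a \<in> carrier A" "b \<in> carrier A" for a b
    using extension s assms(3) that by (simp add: extensions_def induces_representation_def)
  show "bracket E (s a) (s b) (i u) = i (rho a b u)" using assms by (simp add: rho)
  show 2: "bracket E (s a) (i u) (s b) = i (rho b a u)"
    using assms E.bracket_swap(2)[of "s a" "s b" "i u"] by (simp add: rho rho_skew[of a b] i_uminus)
  show "bracket E (i u) (s a) (s b) = i (rho a b u)"
    using assms E.bracket_swap(1)[of "s a" "i u" "s b"] 2 by (simp add: rho_skew[of a b] i_uminus)
qed

text \<open>Of the eight terms of the trilinear expansion, the four with at least two entries from
  \<open>M\<close> vanish. The others give the formula of \<open>twisted_bracket\<close>.\<close>

lemma bracket_decomposed: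
  assumes "a \<in> carrier A" "b \<in> carrier A" "c \<in> carrier A" "u \<in> carrier M" "v \<in> carrier M" "w \<in> carrier M"
  shows "bracket E (s a \<oplus>\<^bsub>E\<^esub> i u) (s b \<oplus>\<^bsub>E\<^esub> i v) (s c \<oplus>\<^bsub>E\<^esub> i w) =
    s (bracket A a b c) \<oplus>\<^bsub>E\<^esub> i (rho b c u \<oplus>\<^bsub>M\<^esub> rho c a v \<oplus>\<^bsub>M\<^esub> rho a b w \<oplus>\<^bsub>M\<^esub> f a b c)"
  using assms
  by (simp add: E.bracket_add bracket_two_i bracket_i bracket_s i_add E.a_ac)

lemma diff_decomposed:
  assumes "a \<in> carrier A" "u \<in> carrier M"
  shows "diff E (s a \<oplus>\<^bsub>E\<^esub> i u) = s (diff A a) \<oplus>\<^bsub>E\<^esub> i (diff M u \<oplus>\<^bsub>M\<^esub> g a)"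
  using assms by (simp add: E.diff_add diff_s diff_i i_add E.a_ac)

lemma section_cocycle_fg:
  "section_cocycle A M (E, i, p) s = (f, g)"
  by (simp add: f_def g_def)

text \<open>Under the injective map \<open>i\<close> the values of \<open>f\<close> become
  differences of expressions that are visibly trilinear and skew-symmetric, and \<open>i\<close>
  reflects both properties.\<close>

lemma f_cochain: "f \<in> cochains3 K A M"
proof -
  have i_f: "i (f a b c) = bracket E (s a) (s b) (s c) \<ominus>\<^bsub>E\<^esub> s (bracket A a b c)"
    if "a \<in> carrier A" "b \<in> carrier A" "c \<in> carrier A" for a b c
    using that by (simp add: bracket_s E.minus_eq E.a_ac E.r_neg E.r_neg2)
  \<comment> \<open>One slot at a time: \<open>y\<close> will be a bracket in \<open>E\<close> and
    \<open>z\<close> a bracket in \<open>A\<close>, each with the other two arguments fixed.\<close>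
  have lin: "h \<in> linear_maps K A M"
    if h: "\<And>a. a \<in> carrier A \<Longrightarrow> h a \<in> carrier M" "\<And>a. a \<in> carrier A \<Longrightarrow> i (h a) = y a \<ominus>\<^bsub>E\<^esub> s (z a)"
      and y: "y \<in> linear_maps K A E" "z \<in> linear_maps K A A" for h y z
    by (rule linear_maps_lift_inj[OF A.module_axioms M.module_axioms i_linear i_inj _ h])
      (intro linear_maps_diff linear_maps_comp[OF y(2) s_linear] y(1) A.module_axioms E.module_axioms)
  have "trilinear K A A A M f"
  proof (rule trilinearI)
    fix b c assume *: "b \<in> carrier A" "c \<in> carrier A"
    show "(\<lambda>a. f a b c) \<in> linear_maps K A M"
      by (rule lin[OF _ i_f]) (simp_all add: * linear_maps_comp[OF s_linear trilinearD(1)[OF E.bracket_trilinear]]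
        trilinearD(1)[OF A.bracket_trilinear])
    show "(\<lambda>a. f b a c) \<in> linear_maps K A M"
      by (rule lin[OF _ i_f]) (simp_all add: * linear_maps_comp[OF s_linear trilinearD(2)[OF E.bracket_trilinear]]
        trilinearD(2)[OF A.bracket_trilinear])
    show "(\<lambda>a. f b c a) \<in> linear_maps K A M"
      by (rule lin[OF _ i_f]) (simp_all add: * linear_maps_comp[OF s_linear trilinearD(3)[OF E.bracket_trilinear]]
        trilinearD(3)[OF A.bracket_trilinear])
  qed
  moreover have "skew3 A M f"
    unfolding skew3_def
  proof (intro ballI conjI)
    fix a b c assume *: "a \<in> carrier A" "b \<in> carrier A" "c \<in> carrier A"
    have "i (f b a c) = i (\<ominus>\<^bsub>M\<^esub> f a b c)"
      using * by (simp add: i_f i_uminus E.bracket_swap[of "s a" "s b" "s c"] A.bracket_swap[of a b c]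
        linear_maps_uminus[OF s_linear A.abelian_group_axioms E.abelian_group_axioms] E.minus_eq E.minus_add)
    then show "f b a c = \<ominus>\<^bsub>M\<^esub> f a b c" using * by simp
    have "i (f a c b) = i (\<ominus>\<^bsub>M\<^esub> f a b c)"
      using * by (simp add: i_f i_uminus E.bracket_swap[of "s a" "s b" "s c"] A.bracket_swap[of a b c]
        linear_maps_uminus[OF s_linear A.abelian_group_axioms E.abelian_group_axioms] E.minus_eq E.minus_add)
    then show "f a c b = \<ominus>\<^bsub>M\<^esub> f a b c" using * by simp
  qed
  moreover have "f \<in> carrier A \<rightarrow>\<^sub>E carrier A \<rightarrow>\<^sub>E carrier A \<rightarrow>\<^sub>E carrier M"
  proof -
    have "(\<lambda>a\<in>carrier A. \<lambda>b\<in>carrier A. \<lambda>c\<in>carrier A. f a b c)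
        \<in> carrier A \<rightarrow>\<^sub>E carrier A \<rightarrow>\<^sub>E carrier A \<rightarrow>\<^sub>E carrier M"
      by (intro restrict_PiE_iff[THEN iffD2] ballI) simp
    moreover have "(\<lambda>a\<in>carrier A. \<lambda>b\<in>carrier A. \<lambda>c\<in>carrier A. f a b c) = f"
      by (simp add: f_def section_cocycle_def cong: restrict_cong)
    ultimately show ?thesis by simp
  qed
  ultimately show ?thesis by (simp add: cochains3_def)
qed

lemma g_cochain: "g \<in> cochains1 K A M"
proof -
  have i_g: "i (g a) = diff E (s a) \<ominus>\<^bsub>E\<^esub> s (diff A a)" if "a \<in> carrier A" for a
    using that by (simp add: diff_s E.minus_eq E.a_ac E.r_neg E.r_neg2)
  have l: "(\<lambda>a. diff E (s a) \<ominus>\<^bsub>E\<^esub> s (diff A a)) \<in> linear_maps K A E"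
    by (intro linear_maps_diff A.module_axioms E.module_axioms
      linear_maps_comp[OF s_linear E.diff_linear] linear_maps_comp[OF A.diff_linear s_linear])
  have "g \<in> linear_maps K A M"
    by (rule linear_maps_lift_inj[OF A.module_axioms M.module_axioms i_linear i_inj l g_closed i_g])
  then have "restrict g (carrier A) \<in> cochains1 K A M" by (rule restrict_cochains1)
  moreover have "restrict g (carrier A) = g" by (simp add: g_def section_cocycle_def)
  ultimately show ?thesis by simp
qed

lemma f_trilinear: "trilinear K A A A M f"
  using f_cochain by (simp add: cochains3_def)

text \<open>The fundamental identity and the rule for the operator are evaluated on section values
  and both sides are written in coordinates. The \<open>A\<close>-coordinates agree because
  \<open>A\<close> satisfies the same identities, so uniqueness equates the
  \<open>M\<close>-coordinates, and these equations are the cocycle conditions.\<close>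

lemma cocycle: "(f, g) \<in> cocycles K lam A M rho"
proof -
  have "delta3 A M rho f a1 a2 a3 a4 a5 = \<zero>\<^bsub>M\<^esub>"
    if a: "a1 \<in> carrier A" "a2 \<in> carrier A" "a3 \<in> carrier A" "a4 \<in> carrier A" "a5 \<in> carrier A"
    for a1 a2 a3 a4 a5
  proof -
    let ?b345 = "bracket A a3 a4 a5" and ?b123 = "bracket A a1 a2 a3"
      and ?b124 = "bracket A a1 a2 a4" and ?b125 = "bracket A a1 a2 a5"
    let ?l = "rho a1 a2 (f a3 a4 a5) \<oplus>\<^bsub>M\<^esub> f a1 a2 ?b345"
    let ?r = "rho a4 a5 (f a1 a2 a3) \<oplus>\<^bsub>M\<^esub> f ?b123 a4 a5 \<oplus>\<^bsub>M\<^esub> (rho a5 a3 (f a1 a2 a4) \<oplus>\<^bsub>M\<^esub> f a3 ?b124 a5)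
      \<oplus>\<^bsub>M\<^esub> (rho a3 a4 (f a1 a2 a5) \<oplus>\<^bsub>M\<^esub> f a3 a4 ?b125)"
    have "s (bracket A a1 a2 ?b345) \<oplus>\<^bsub>E\<^esub> i ?l =
        bracket E (s a1) (s a2) (bracket E (s a3) (s a4) (s a5))"
      using a by (simp add: bracket_s E.bracket_add bracket_i i_add E.a_ac)
    also have "\<dots> = bracket E (bracket E (s a1) (s a2) (s a3)) (s a4) (s a5)
        \<oplus>\<^bsub>E\<^esub> bracket E (s a3) (bracket E (s a1) (s a2) (s a4)) (s a5)
        \<oplus>\<^bsub>E\<^esub> bracket E (s a3) (s a4) (bracket E (s a1) (s a2) (s a5))"
      using a by (intro E.fundamental_identity) simp_all
    also have "\<dots> = s (bracket A ?b123 a4 a5 \<oplus>\<^bsub>A\<^esub> bracket A a3 ?b124 a5 \<oplus>\<^bsub>A\<^esub> bracket A a3 a4 ?b125) \<oplus>\<^bsub>E\<^esub> i ?r"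
      using a by (simp add: bracket_s E.bracket_add bracket_i i_add s_add E.a_ac)
    finally have "?l = ?r"
      using a by (intro conjunct2[OF decomposition_unique]) (simp_all add: A.fundamental_identity[OF a])
    then show ?thesis using delta3_eq_zero_iff[OF f_trilinear a] by simp
  qed
  moreover have "delta1 A M rho g a1 a2 a3 \<oplus>\<^bsub>M\<^esub> Phi3 lam A M f a1 a2 a3 = \<zero>\<^bsub>M\<^esub>"
    if a: "a1 \<in> carrier A" "a2 \<in> carrier A" "a3 \<in> carrier A" for a1 a2 a3
  proof -
    let ?l = "g (bracket A a1 a2 a3) \<oplus>\<^bsub>M\<^esub> diff M (f a1 a2 a3)"
    let ?r = "rho a2 a3 (g a1) \<oplus>\<^bsub>M\<^esub> f (diff A a1) a2 a3 \<oplus>\<^bsub>M\<^esub> (rho a3 a1 (g a2) \<oplus>\<^bsub>M\<^esub> f a1 (diff A a2) a3)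
      \<oplus>\<^bsub>M\<^esub> (rho a1 a2 (g a3) \<oplus>\<^bsub>M\<^esub> f a1 a2 (diff A a3)) \<oplus>\<^bsub>M\<^esub> lam \<odot>\<^bsub>M\<^esub> f a1 a2 a3"
    have "s (diff A (bracket A a1 a2 a3)) \<oplus>\<^bsub>E\<^esub> i ?l = diff E (bracket E (s a1) (s a2) (s a3))"
      using a by (simp add: bracket_s diff_s diff_i E.diff_add i_add E.a_ac)
    also have "\<dots> = bracket E (diff E (s a1)) (s a2) (s a3) \<oplus>\<^bsub>E\<^esub> bracket E (s a1) (diff E (s a2)) (s a3)
        \<oplus>\<^bsub>E\<^esub> bracket E (s a1) (s a2) (diff E (s a3)) \<oplus>\<^bsub>E\<^esub> lam \<odot>\<^bsub>E\<^esub> bracket E (s a1) (s a2) (s a3)"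
      using a by (intro E.diff_bracket) simp_all
    also have "\<dots> = s (bracket A (diff A a1) a2 a3 \<oplus>\<^bsub>A\<^esub> bracket A a1 (diff A a2) a3
        \<oplus>\<^bsub>A\<^esub> bracket A a1 a2 (diff A a3) \<oplus>\<^bsub>A\<^esub> lam \<odot>\<^bsub>A\<^esub> bracket A a1 a2 a3) \<oplus>\<^bsub>E\<^esub> i ?r"
      using a by (simp add: bracket_s diff_s E.bracket_add bracket_i i_add s_add i_smult s_smult
        E.smult_r_distr E.a_ac)
    finally have "?l = ?r"
      using a by (intro conjunct2[OF decomposition_unique]) (simp_all add: A.diff_bracket[OF a])
    then show ?thesis using delta1_Phi3_eq_zero_iff[OF f_trilinear cochains1_linear[OF g_cochain] a] by simp
  qed
  ultimately show ?thesis using f_cochain g_cochain by (simp add: cocycles_def)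
qed

lemma decomposed_add:
  assumes "a \<in> carrier A" "b \<in> carrier A" "u \<in> carrier M" "v \<in> carrier M"
  shows "(s a \<oplus>\<^bsub>E\<^esub> i u) \<oplus>\<^bsub>E\<^esub> (s b \<oplus>\<^bsub>E\<^esub> i v) = s (a \<oplus>\<^bsub>A\<^esub> b) \<oplus>\<^bsub>E\<^esub> i (u \<oplus>\<^bsub>M\<^esub> v)"
  using assms by (simp add: s_add i_add E.a_ac)

lemma decomposed_smult:
  assumes "k \<in> carrier K" "a \<in> carrier A" "u \<in> carrier M"
  shows "k \<odot>\<^bsub>E\<^esub> (s a \<oplus>\<^bsub>E\<^esub> i u) = s (k \<odot>\<^bsub>A\<^esub> a) \<oplus>\<^bsub>E\<^esub> i (k \<odot>\<^bsub>M\<^esub> u)"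
  using assms by (simp add: s_smult i_smult E.smult_r_distr)

section \<open>Change of section\<close>

text \<open>With respect to \<open>s\<close>, the element \<open>s' a\<close> has coordinates
  \<open>a\<close> and \<open>h a\<close>, so its brackets and the operator on it are known from
  \<open>bracket_decomposed\<close> and \<open>diff_decomposed\<close>. Rewriting the results in the
  coordinates of \<open>s'\<close> produces the coboundary.\<close>

lemma section_cocycle_shift:
  assumes s': "s' \<in> sections K A (E, i, p)" and h: "h \<in> cochains1 K A M"
    and eq: "\<And>a. a \<in> carrier A \<Longrightarrow> s' a = s a \<oplus>\<^bsub>E\<^esub> i (h a)"
  shows "section_cocycle A M (E, i, p) s' = coboundary h \<otimes>\<^bsub>Z\<^esub> section_cocycle A M (E, i, p) s"
proof -
  interpret S': extension_section K A M lam rho E i p s'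
    using s' by unfold_locales
  note h_closed = cochains1_closed[OF h]
  show ?thesis
    unfolding section_cocycle_fg coboundary_mult
  proof (intro S'.section_cocycle_eqI conjI)
    fix a b c assume *: "a \<in> carrier A" "b \<in> carrier A" "c \<in> carrier A"
    let ?d = "delta1 A M rho h a b c \<oplus>\<^bsub>M\<^esub> f a b c"
    let ?x = "rho b c (h a) \<oplus>\<^bsub>M\<^esub> rho c a (h b) \<oplus>\<^bsub>M\<^esub> rho a b (h c) \<oplus>\<^bsub>M\<^esub> f a b c"
    show d: "?d \<in> carrier M"
      using * by (simp add: delta1_closed cochains1_linear[OF h])
    \<comment> \<open>\<open>?x\<close> is the \<open>M\<close>-coordinate of the bracket with
      respect to \<open>s\<close>; passing to \<open>s'\<close> subtracts the value of
      \<open>h\<close> at the \<open>A\<close>-coordinate.\<close>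
    have "?d = ?x \<ominus>\<^bsub>M\<^esub> h (bracket A a b c)"
      using * by (simp add: delta1_def h_closed M.minus_eq M.a_ac)
    then have "h (bracket A a b c) \<oplus>\<^bsub>M\<^esub> ?d = ?x"
      using * h_closed by (simp add: M.add_minus_cancel)
    then show "bracket E (s' a) (s' b) (s' c) = s' (bracket A a b c) \<oplus>\<^bsub>E\<^esub> i ?d"
      using * d by (simp add: eq bracket_decomposed h_closed E.a_assoc flip: i_add)
  next
    fix a assume *: "a \<in> carrier A"
    let ?d = "\<ominus>\<^bsub>M\<^esub> Phi1 A M h a \<oplus>\<^bsub>M\<^esub> g a"
    show d: "?d \<in> carrier M"
      using * by (simp add: Phi1_closed cochains1_linear[OF h])
    \<comment> \<open>The same passage for the operator. It puts the minus sign on the value of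
      \<open>h\<close> at \<open>diff A a\<close>, whence the negated \<open>Phi1\<close> in the
      definition of coboundaries.\<close>
    have "?d = (diff M (h a) \<oplus>\<^bsub>M\<^esub> g a) \<ominus>\<^bsub>M\<^esub> h (diff A a)"
      using * by (simp add: Phi1_def h_closed M.minus_eq M.minus_add M.a_ac)
    then have "h (diff A a) \<oplus>\<^bsub>M\<^esub> ?d = diff M (h a) \<oplus>\<^bsub>M\<^esub> g a"
      using * h_closed by (simp add: M.add_minus_cancel)
    then show "diff E (s' a) = s' (diff A a) \<oplus>\<^bsub>E\<^esub> i ?d"
      using * d by (simp add: eq diff_decomposed h_closed E.a_assoc flip: i_add)
  qed
qed

text \<open>Together with \<open>section_cocycle_shift\<close> this shows that every element of the
  coset is itself the cocycle of some section.\<close>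

lemma shifted_section:
  assumes h: "h \<in> cochains1 K A M"
  shows "(\<lambda>a. s a \<oplus>\<^bsub>E\<^esub> i (h a)) \<in> sections K A (E, i, p)"
proof -
  have "(\<lambda>a. s a \<oplus>\<^bsub>E\<^esub> i (h a)) \<in> linear_maps K A E"
    by (intro linear_maps_plus A.module_axioms E.module_axioms s_linear
      linear_maps_comp[OF cochains1_linear[OF h] i_linear])
  then show ?thesis using cochains1_closed[OF h] by (simp add: sections_def p_decomposed)
qed

text \<open>The difference of two sections is killed by \<open>p\<close>, so it can be pulled back
  along \<open>i\<close>, linearly by \<open>linear_maps_lift_inj\<close>.\<close>

lemma sections_differ_by_cochain:
  assumes s': "s' \<in> sections K A (E, i, p)"
  obtains h where "h \<in> cochains1 K A M" "\<And>a. a \<in> carrier A \<Longrightarrow> s' a = s a \<oplus>\<^bsub>E\<^esub> i (h a)"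
proof
  interpret S': extension_section K A M lam rho E i p s'
    using s' by unfold_locales
  let ?h = "\<lambda>a. inv_into (carrier M) i (s' a \<ominus>\<^bsub>E\<^esub> s a)"
  have y: "s' a \<ominus>\<^bsub>E\<^esub> s a \<in> carrier E" "p (s' a \<ominus>\<^bsub>E\<^esub> s a) = \<zero>\<^bsub>A\<^esub>" if "a \<in> carrier A" for a
    using that by (simp_all add: p_minus A.minus_eq A.r_neg)
  have l: "(\<lambda>a. s' a \<ominus>\<^bsub>E\<^esub> s a) \<in> linear_maps K A E"
    by (intro linear_maps_diff A.module_axioms E.module_axioms s_linear S'.s_linear)
  have "?h \<in> linear_maps K A M"
    by (rule linear_maps_lift_inj[OF A.module_axioms M.module_axioms i_linear i_inj l])
      (simp_all add: kernel_i y)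
  \<comment> \<open>Sections are arbitrary outside the carrier, while cochains are
    extensional.\<close>
  then show "restrict ?h (carrier A) \<in> cochains1 K A M" by (rule restrict_cochains1)
  show "s' a = s a \<oplus>\<^bsub>E\<^esub> i (restrict ?h (carrier A) a)" if "a \<in> carrier A" for a
    using that by (simp add: kernel_i y E.add_minus_cancel)
qed

lemma coset_independent:
  assumes s': "s' \<in> sections K A (E, i, p)"
  shows "B #>\<^bsub>Z\<^esub> section_cocycle A M (E, i, p) s' = B #>\<^bsub>Z\<^esub> section_cocycle A M (E, i, p) s"
proof -
  obtain h where h: "h \<in> cochains1 K A M" "\<And>a. a \<in> carrier A \<Longrightarrow> s' a = s a \<oplus>\<^bsub>E\<^esub> i (h a)"
    using sections_differ_by_cochain[OF s'] by blast
  show ?thesis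
    using section_cocycle_shift[OF s' h] coset_coboundary_mult[OF h(1) cocycle]
    by (simp add: section_cocycle_fg)
qed

end

section \<open>Comparison of two extensions\<close>

text \<open>Applying \<open>eta\<close> to the equations \<open>bracket_s\<close> and
  \<open>diff_s\<close> of the first extension gives those of the second with the same pair, because
  \<open>eta\<close> turns \<open>i1\<close> into \<open>i2\<close>.\<close>

lemma section_along_equivalence:
  assumes "extension_section K A M lam rho E1 i1 p1 s1" and "extension K A M lam rho E2 i2 p2"
    and eta: "eta \<in> md_hom K E1 E2" "\<And>u. u \<in> carrier M \<Longrightarrow> eta (i1 u) = i2 u"
      "\<And>x. x \<in> carrier E1 \<Longrightarrow> p2 (eta x) = p1 x"
  shows "(\<lambda>a. eta (s1 a)) \<in> sections K A (E2, i2, p2)"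
    and "section_cocycle A M (E2, i2, p2) (\<lambda>a. eta (s1 a)) = section_cocycle A M (E1, i1, p1) s1"
proof -
  interpret X1: extension_section K A M lam rho E1 i1 p1 s1 by fact
  interpret X2: extension K A M lam rho E2 i2 p2 by fact
  have lin: "eta \<in> linear_maps K E1 E2" using eta(1) by (simp add: md_hom_def)
  show sec: "(\<lambda>a. eta (s1 a)) \<in> sections K A (E2, i2, p2)"
    using linear_maps_comp[OF X1.s_linear lin] eta(3) by (simp add: sections_def)
  interpret Y: extension_section K A M lam rho E2 i2 p2 "\<lambda>a. eta (s1 a)"
    using sec by unfold_locales
  have "section_cocycle A M (E2, i2, p2) (\<lambda>a. eta (s1 a)) =
      (\<lambda>a\<in>carrier A. \<lambda>b\<in>carrier A. \<lambda>c\<in>carrier A. X1.f a b c, \<lambda>a\<in>carrier A. X1.g a)"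
  proof (intro Y.section_cocycle_eqI conjI)
    fix a b c assume *: "a \<in> carrier A" "b \<in> carrier A" "c \<in> carrier A"
    have "bracket E2 (eta (s1 a)) (eta (s1 b)) (eta (s1 c)) = eta (bracket E1 (s1 a) (s1 b) (s1 c))"
      using eta(1) * by (simp add: md_hom_def)
    then show "bracket E2 (eta (s1 a)) (eta (s1 b)) (eta (s1 c)) =
        eta (s1 (bracket A a b c)) \<oplus>\<^bsub>E2\<^esub> i2 (X1.f a b c)"
      using * by (simp add: X1.bracket_s linear_maps_add[OF lin] eta(2))
  next
    fix a assume *: "a \<in> carrier A"
    have "diff E2 (eta (s1 a)) = eta (diff E1 (s1 a))"
      using eta(1) * by (simp add: md_hom_def)
    then show "diff E2 (eta (s1 a)) = eta (s1 (diff A a)) \<oplus>\<^bsub>E2\<^esub> i2 (X1.g a)"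
      using * by (simp add: X1.diff_s linear_maps_add[OF lin] eta(2))
  qed simp_all
  then show "section_cocycle A M (E2, i2, p2) (\<lambda>a. eta (s1 a)) = section_cocycle A M (E1, i1, p1) s1"
    by (simp add: X1.section_cocycle_fg X1.cochains3_restrict[OF X1.f_cochain]
      X1.cochains1_restrict[OF X1.g_cochain])
qed

text \<open>In coordinates both structures are given by the same formulas in \<open>rho\<close> and
  the common cocycle, so matching coordinates respects all operations.\<close>

lemma equal_section_cocycles_imp_equivalent:
  assumes "extension_section K A M lam rho E1 i1 p1 s1" and "extension_section K A M lam rho E2 i2 p2 s2"
    and eq: "section_cocycle A M (E1, i1, p1) s1 = section_cocycle A M (E2, i2, p2) s2"
  shows "equivalent_extensions K M (E1, i1, p1) (E2, i2, p2)"
proof -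
  interpret X1: extension_section K A M lam rho E1 i1 p1 s1 by fact
  interpret X2: extension_section K A M lam rho E2 i2 p2 s2 by fact
  have fg: "X1.f = X2.f" "X1.g = X2.g" using eq by (simp_all add: X1.section_cocycle_fg X2.section_cocycle_fg)
  \<comment> \<open>The coordinates of \<open>x\<close> along \<open>s1\<close> are
    \<open>p1 x\<close> and the preimage of the remainder; \<open>eta\<close> reassembles them along
    \<open>s2\<close>.\<close>
  define eta where "eta x = s2 (p1 x) \<oplus>\<^bsub>E2\<^esub> i2 (inv_into (carrier M) i1 (x \<ominus>\<^bsub>E1\<^esub> s1 (p1 x)))" for x
  have eta: "eta (s1 a \<oplus>\<^bsub>E1\<^esub> i1 u) = s2 a \<oplus>\<^bsub>E2\<^esub> i2 u" if "a \<in> carrier A" "u \<in> carrier M" for a u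
  proof -
    have "(s1 a \<oplus>\<^bsub>E1\<^esub> i1 u) \<ominus>\<^bsub>E1\<^esub> s1 a = i1 u"
      using that by (simp add: X1.E.minus_eq X1.E.a_ac X1.E.r_neg X1.E.r_neg2)
    then show ?thesis
      using that by (simp add: eta_def X1.p_decomposed inv_into_f_f[OF X1.i_inj])
  qed
  have lin: "eta \<in> linear_maps K E1 E2"
  proof (rule linear_mapsI)
    show "eta x \<in> carrier E2" if "x \<in> carrier E1" for x
      by (rule X1.decompose[OF that]) (simp add: eta)
    show "eta (x \<oplus>\<^bsub>E1\<^esub> y) = eta x \<oplus>\<^bsub>E2\<^esub> eta y" if "x \<in> carrier E1" "y \<in> carrier E1" for x y
      by (rule X1.decompose[OF that(1)], rule X1.decompose[OF that(2)])
        (simp add: eta X1.decomposed_add X2.decomposed_add)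
    show "eta (k \<odot>\<^bsub>E1\<^esub> x) = k \<odot>\<^bsub>E2\<^esub> eta x" if "k \<in> carrier K" "x \<in> carrier E1" for k x
      by (rule X1.decompose[OF that(2)])
        (simp add: eta X1.decomposed_smult X2.decomposed_smult that)
  qed
  have "eta (bracket E1 x y z) = bracket E2 (eta x) (eta y) (eta z)"
    if "x \<in> carrier E1" "y \<in> carrier E1" "z \<in> carrier E1" for x y z
    by (rule X1.decompose[OF that(1)], rule X1.decompose[OF that(2)], rule X1.decompose[OF that(3)])
      (simp add: eta X1.bracket_decomposed X2.bracket_decomposed fg)
  moreover have "eta (diff E1 x) = diff E2 (eta x)" if "x \<in> carrier E1" for x
    by (rule X1.decompose[OF that]) (simp add: eta X1.diff_decomposed X2.diff_decomposed fg)
  moreover have "bij_betw eta (carrier E1) (carrier E2)"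
  proof (rule bij_betwI')
    show "eta x = eta y \<longleftrightarrow> x = y" if xy: "x \<in> carrier E1" "y \<in> carrier E1" for x y
    proof
      assume eq: "eta x = eta y"
      obtain a u where x: "a \<in> carrier A" "u \<in> carrier M" "x = s1 a \<oplus>\<^bsub>E1\<^esub> i1 u"
        by (rule X1.decompose[OF xy(1)])
      obtain b v where y: "b \<in> carrier A" "v \<in> carrier M" "y = s1 b \<oplus>\<^bsub>E1\<^esub> i1 v"
        by (rule X1.decompose[OF xy(2)])
      have "a = b \<and> u = v"
        using eq x y by (intro X2.decomposition_unique) (simp_all add: eta)
      then show "x = y" using x y by simp
    qed simp
    show "eta x \<in> carrier E2" if "x \<in> carrier E1" for x
      using linear_maps_closed[OF lin that] .
    show "\<exists>x\<in>carrier E1. y = eta x" if "y \<in> carrier E2" for y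
    proof (rule X2.decompose[OF that])
      fix a u assume "a \<in> carrier A" "u \<in> carrier M" "y = s2 a \<oplus>\<^bsub>E2\<^esub> i2 u"
      then show ?thesis by (intro bexI[of _ "s1 a \<oplus>\<^bsub>E1\<^esub> i1 u"]) (simp_all add: eta)
    qed
  qed
  ultimately have "eta \<in> md_iso K E1 E2"
    using lin by (simp add: md_iso_def md_hom_def)
  \<comment> \<open>Elements of \<open>M\<close> have first coordinate zero, where both sections
    vanish.\<close>
  moreover have "eta (i1 u) = i2 u" if "u \<in> carrier M" for u
    using eta[of "\<zero>\<^bsub>A\<^esub>" u] that by (simp add: X1.s_zero X2.s_zero)
  moreover have "p2 (eta x) = p1 x" if "x \<in> carrier E1" for x
    by (rule X1.decompose[OF that]) (simp add: eta X1.p_decomposed X2.p_decomposed)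
  ultimately show ?thesis unfolding equivalent_extensions_def by blast
qed

section \<open>Every cocycle comes from an extension\<close>

context twisted
begin

abbreviation incl where "incl u \<equiv> j (\<zero>\<^bsub>A\<^esub>, u)"
abbreviation proj where "proj x \<equiv> fst (inv_into (carrier A \<times> carrier M) j x)"

lemma proj_j [simp]: "\<lbrakk>a \<in> carrier A; u \<in> carrier M\<rbrakk> \<Longrightarrow> proj (j (a, u)) = a"
  using inj_j by simp

lemma f_zero [simp]: "\<lbrakk>a \<in> carrier A; b \<in> carrier A\<rbrakk> \<Longrightarrow> f a b \<zero>\<^bsub>A\<^esub> = \<zero>\<^bsub>M\<^esub>"
    "\<lbrakk>a \<in> carrier A; b \<in> carrier A\<rbrakk> \<Longrightarrow> f a \<zero>\<^bsub>A\<^esub> b = \<zero>\<^bsub>M\<^esub>"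
    "\<lbrakk>a \<in> carrier A; b \<in> carrier A\<rbrakk> \<Longrightarrow> f \<zero>\<^bsub>A\<^esub> a b = \<zero>\<^bsub>M\<^esub>"
  by (simp_all add: trilinear_zero[OF f_tri A.abelian_group_axioms A.abelian_group_axioms
      A.abelian_group_axioms M.abelian_group_axioms])

lemma bracket_zero [simp]: "\<lbrakk>a \<in> carrier A; b \<in> carrier A\<rbrakk> \<Longrightarrow> bracket A a b \<zero>\<^bsub>A\<^esub> = \<zero>\<^bsub>A\<^esub>"
    "\<lbrakk>a \<in> carrier A; b \<in> carrier A\<rbrakk> \<Longrightarrow> bracket A a \<zero>\<^bsub>A\<^esub> b = \<zero>\<^bsub>A\<^esub>"
    "\<lbrakk>a \<in> carrier A; b \<in> carrier A\<rbrakk> \<Longrightarrow> bracket A \<zero>\<^bsub>A\<^esub> a b = \<zero>\<^bsub>A\<^esub>"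
  by (simp_all add: trilinear_zero[OF A.bracket_trilinear A.abelian_group_axioms A.abelian_group_axioms
      A.abelian_group_axioms A.abelian_group_axioms])

lemma diff_zero [simp]: "diff A \<zero>\<^bsub>A\<^esub> = \<zero>\<^bsub>A\<^esub>" "g \<zero>\<^bsub>A\<^esub> = \<zero>\<^bsub>M\<^esub>"
  by (simp_all add: linear_maps_zero[OF A.diff_linear A.abelian_group_axioms A.abelian_group_axioms]
      linear_maps_zero[OF g_linear A.abelian_group_axioms M.abelian_group_axioms])

text \<open>The induced representation is a condition on all sections, and a section of
  \<open>proj\<close> may have any \<open>M\<close>-coordinate. This lemma exposes that
  coordinate.\<close>

lemma proj_section:
  assumes "s \<in> sections K A (Q, incl, proj)" "a \<in> carrier A"
  obtains u where "u \<in> carrier M" "s a = j (a, u)"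
proof -
  have s: "s \<in> linear_maps K A Q" "proj (s a) = a" using assms by (simp_all add: sections_def)
  obtain b u where "b \<in> carrier A" "u \<in> carrier M" "s a = j (b, u)"
    using Q_cases[OF linear_maps_closed[OF s(1) assms(2)]] .
  with s(2) that show ?thesis by simp
qed

lemma twisted_extension: "(Q, incl, proj) \<in> extensions K lam A M rho"
proof -
  have "incl \<in> md_hom K M Q"
    unfolding md_hom_def using bracket_M
    by (auto intro!: linear_mapsI simp: rho_zero)
  moreover have "proj \<in> md_hom K Q A"
    unfolding md_hom_def by (auto intro!: linear_mapsI)
  moreover have "inj_on incl (carrier M)" by (rule inj_onI) simp
  moreover have "incl ` carrier M = a_kernel Q A proj" by (auto simp: a_kernel_def')
  moreover have "proj ` carrier Q = carrier A"
  proof (intro equalityI subsetI)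
    fix a assume "a \<in> carrier A"
    then show "a \<in> proj ` carrier Q" by (intro image_eqI[of _ _ "j (a, \<zero>\<^bsub>M\<^esub>)"]) auto
  qed auto
  moreover have "bracket Q x (incl u) (incl v) = \<zero>\<^bsub>Q\<^esub>"
    if "x \<in> carrier Q" "u \<in> carrier M" "v \<in> carrier M" for x u v
    using that by (auto simp: rho_zero)
  ultimately have "abelian_extension K lam A M (Q, incl, proj)"
    using Q_md_3lie_algebra by (simp add: abelian_extension_def)
  \<comment> \<open>The unknown \<open>M\<close>-coordinates of the section values occur only in
    \<open>rho\<close> terms whose other entries include the zero \<open>A\<close>-coordinate of
    \<open>incl u\<close>, so they drop out.\<close>
  moreover have "incl (rho a b u) = bracket Q (s a) (s b) (incl u)"
    if s: "s \<in> sections K A (Q, incl, proj)" and *: "a \<in> carrier A" "b \<in> carrier A" "u \<in> carrier M"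
    for s a b u
    by (rule proj_section[OF s *(1)], rule proj_section[OF s *(2)]) (simp add: * rho_zero)
  ultimately show ?thesis by (simp add: extensions_def induces_representation_def)
qed

lemma twisted_section: "(\<lambda>a. j (a, \<zero>\<^bsub>M\<^esub>)) \<in> sections K A (Q, incl, proj)"
  by (auto simp: sections_def intro!: linear_mapsI)

text \<open>On pairs with zero \<open>M\<close>-coordinate the twisted operations differ from those
  of \<open>A\<close> exactly by \<open>f\<close> and \<open>g\<close>. Hence the prescribed cocycle
  is recovered on the nose, not just up to a coboundary.\<close>

lemma twisted_section_cocycle: "section_cocycle A M (Q, incl, proj) (\<lambda>a. j (a, \<zero>\<^bsub>M\<^esub>)) = (f, g)"
proof -
  interpret Q: extension_section K A M lam rho Q incl proj "\<lambda>a. j (a, \<zero>\<^bsub>M\<^esub>)"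
    using twisted_extension twisted_section by unfold_locales
  have "section_cocycle A M (Q, incl, proj) (\<lambda>a. j (a, \<zero>\<^bsub>M\<^esub>)) =
      (\<lambda>a\<in>carrier A. \<lambda>b\<in>carrier A. \<lambda>c\<in>carrier A. f a b c, \<lambda>a\<in>carrier A. g a)"
    by (rule Q.section_cocycle_eqI) (simp_all add: rho_zero diff_M_zero)
  then show ?thesis by (simp add: cochains3_restrict[OF f_cochain] cochains1_restrict[OF g_cochain])
qed

end

section \<open>The correspondence\<close>

theorem theorem4p5:
  fixes K :: "('k, 'r) ring_scheme" and lam :: 'k
    and A :: "('k, 'a) diff_3alg" and M :: "('k, 'm) diff_3alg"
    and rho :: "'a \<Rightarrow> 'a \<Rightarrow> 'm \<Rightarrow> 'm"
    and j :: "'a \<times> 'm \<Rightarrow> 'e"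
  assumes field_K: "char_zero_field K"
    and lam: "lam \<in> carrier K"
    and A: "md_3lie_algebra K lam A"
    and M: "module K M" "diff M \<in> linear_maps K M M"
    and M_bracket: "\<And>u v w. \<lbrakk>u \<in> carrier M; v \<in> carrier M; w \<in> carrier M\<rbrakk> \<Longrightarrow> bracket M u v w = \<zero>\<^bsub>M\<^esub>"
    and rho: "md_representation K lam A M rho"
    \<comment> \<open>the type of the middle terms has room for the underlying set of \<open>A \<oplus> M\<close>\<close>
    and j: "inj_on j (carrier A \<times> carrier M)"
  shows "\<exists>F. bij_betw F
        ((extensions K lam A M rho :: ('k, 'a, 'm, 'e) ext set) // extension_equiv K lam A M rho)
        (carrier (H2 K lam A M rho)) \<and>
      (\<forall>X \<in> extensions K lam A M rho. \<forall>s \<in> sections K A X.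
        F (extension_equiv K lam A M rho `` {X}) =
          coboundaries K A M rho #>\<^bsub>cocycle_group K lam A M rho\<^esub> section_cocycle A M X s)"
proof -
  interpret K: field K using field_K by (rule char_zero_field.axioms)
  interpret coefficient_system K A M lam rho
    by (intro coefficient_system.intro coefficient_system_axioms.intro K.field_axioms rho lam M_bracket)
  let ?X = "extensions K lam A M rho :: ('k, 'a, 'm, 'e) ext set"
  let ?r = "extension_equiv K lam A M rho :: ('k, 'a, 'm, 'e) ext rel"
  have ext: "extension K A M lam rho E i p" if "(E, i, p) \<in> ?X" for E i p
    using that by unfold_locales
  have sec: "extension_section K A M lam rho E i p s" if "(E, i, p) \<in> ?X" "s \<in> sections K A (E, i, p)" for E i p s
    using that by unfold_locales
  \<comment> \<open>The section is picked arbitrarily; \<open>coset_independent\<close> then allows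
    any other section in its place, which also yields the second conjunct of the claim.\<close>
  define chi where "chi X = B #>\<^bsub>Z\<^esub> section_cocycle A M X (SOME s. s \<in> sections K A X)"
    for X :: "('k, 'a, 'm, 'e) ext"
  have some: "(SOME s. s \<in> sections K A X) \<in> sections K A X" if "X \<in> ?X" for X
  proof -
    obtain E i p where X: "X = (E, i, p)" by (rule prod_cases3)
    show ?thesis
      unfolding X by (rule someI_ex[OF extension.section_exists[OF ext[OF that[unfolded X]]]])
  qed
  have chi: "chi X = B #>\<^bsub>Z\<^esub> section_cocycle A M X s" if X: "X \<in> ?X" and s: "s \<in> sections K A X" for X s
  proof -
    obtain E i p where E: "X = (E, i, p)" by (rule prod_cases3)
    show ?thesis
      unfolding E chi_def
      by (rule extension_section.coset_independent[OF sec[OF X[unfolded E] s[unfolded E]]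
            some[OF X, unfolded E]])
  qed
  \<comment> \<open>Equivalence of extensions is equality of \<open>chi\<close>, so the classes are
    the fibres of \<open>chi\<close>.\<close>
  have equiv: "(X, Y) \<in> ?r \<longleftrightarrow> X \<in> ?X \<and> Y \<in> ?X \<and> chi X = chi Y" for X Y
  proof -
    obtain E1 i1 p1 E2 i2 p2 where E: "X = (E1, i1, p1)" "Y = (E2, i2, p2)"
      by (metis prod_cases3)
    have "chi X = chi Y" if X: "X \<in> ?X" "Y \<in> ?X" and eq: "equivalent_extensions K M X Y"
    proof -
      obtain eta where eta: "eta \<in> md_hom K E1 E2" "\<And>u. u \<in> carrier M \<Longrightarrow> eta (i1 u) = i2 u"
        "\<And>x. x \<in> carrier E1 \<Longrightarrow> p2 (eta x) = p1 x"
        using eq unfolding E equivalent_extensions_def md_iso_def by blast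
      obtain s where s: "s \<in> sections K A X" using some[OF X(1)] by blast
      note along = section_along_equivalence[OF sec[OF X(1)[unfolded E] s[unfolded E]] ext[OF X(2)[unfolded E]] eta]
      show ?thesis
        using chi[OF X(1) s] chi[OF X(2)] along unfolding E by simp
    qed
    moreover have "equivalent_extensions K M X Y" if X: "X \<in> ?X" "Y \<in> ?X" and eq: "chi X = chi Y"
    proof -
      obtain s t where s: "s \<in> sections K A X" and t: "t \<in> sections K A Y"
        using some[OF X(1)] some[OF X(2)] by blast
      interpret S: extension_section K A M lam rho E1 i1 p1 s
        using sec X(1) s unfolding E by blast
      interpret T: extension_section K A M lam rho E2 i2 p2 t
        using sec X(2) t unfolding E by blast
      have "B #>\<^bsub>Z\<^esub> section_cocycle A M X s = B #>\<^bsub>Z\<^esub> section_cocycle A M Y t"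
        using chi[OF X(1) s] chi[OF X(2) t] eq by simp
      then obtain h where h: "h \<in> cochains1 K A M"
        "section_cocycle A M X s = coboundary h \<otimes>\<^bsub>Z\<^esub> section_cocycle A M Y t"
        using coset_eqD[OF S.cocycle] unfolding E S.section_cocycle_fg by blast
      \<comment> \<open>Moving \<open>t\<close> by \<open>h\<close> absorbs the coboundary by which
        the two cocycles differ.\<close>
      note t' = T.shifted_section[OF h(1)]
      have "section_cocycle A M X s = section_cocycle A M Y (\<lambda>a. t a \<oplus>\<^bsub>E2\<^esub> i2 (h a))"
        using T.section_cocycle_shift[OF t' h(1)] h(2) unfolding E by simp
      then show ?thesis
        using equal_section_cocycles_imp_equivalent[OF S.extension_section_axioms sec[OF X(2)[unfolded E] t']]
        unfolding E by blast
    qed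
    ultimately show ?thesis by (auto simp: extension_equiv_def)
  qed
  have cls: "?r `` {X} = {Y \<in> ?X. chi Y = chi X}" if "X \<in> ?X" for X
  proof (rule Set.set_eqI)
    show "Y \<in> ?r `` {X} \<longleftrightarrow> Y \<in> {Y \<in> ?X. chi Y = chi X}" for Y
      using that by (simp only: Image_singleton_iff equiv mem_Collect_eq) metis
  qed
  \<comment> \<open>\<open>chi\<close> is constant on each class, so its image there is a singleton
    and \<open>the_elem\<close> reads off the value.\<close>
  define F where "F C = the_elem (chi ` C)" for C
  have F: "F (?r `` {X}) = chi X" if "X \<in> ?X" for X
  proof -
    have "chi ` (?r `` {X}) = {chi X}" unfolding cls[OF that] using that by auto
    then show ?thesis by (simp add: F_def)
  qed
  have "chi ` ?X = carrier (H2 K lam A M rho)"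
  proof (intro equalityI subsetI)
    fix C assume "C \<in> chi ` ?X"
    then obtain E i p where X: "(E, i, p) \<in> ?X" "C = chi (E, i, p)" by auto
    obtain s where s: "s \<in> sections K A (E, i, p)" using some[OF X(1)] by blast
    interpret S: extension_section K A M lam rho E i p s by (rule sec[OF X(1) s])
    show "C \<in> carrier (H2 K lam A M rho)"
      unfolding carrier_H2 X(2) chi[OF X(1) s] S.section_cocycle_fg using S.cocycle by (rule imageI)
  next
    fix C assume "C \<in> carrier (H2 K lam A M rho)"
    then obtain f g where fg: "(f, g) \<in> cocycles K lam A M rho" "C = B #>\<^bsub>Z\<^esub> (f, g)"
      unfolding carrier_H2 by auto
    \<comment> \<open>Surjectivity: \<open>j\<close> places the twisted product of the given cocycle
      inside \<open>'e\<close>.\<close>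
    interpret T: twisted K A M lam rho j f g
      using j fg(1) by unfold_locales
    have "C = chi (T.Q, T.incl, T.proj)"
      unfolding chi[OF T.twisted_extension T.twisted_section] T.twisted_section_cocycle fg(2) ..
    then show "C \<in> chi ` ?X" using T.twisted_extension by blast
  qed
  moreover have "F ` (?X // ?r) = chi ` ?X"
    using F by (force simp: quotient_def)
  moreover have "inj_on F (?X // ?r)"
  proof (rule inj_onI)
    fix C D assume "C \<in> ?X // ?r" "D \<in> ?X // ?r" and eq: "F C = F D"
    then obtain X Y where "X \<in> ?X" "C = ?r `` {X}" "Y \<in> ?X" "D = ?r `` {Y}"
      by (elim quotientE)
    with eq F cls show "C = D" by simp
  qed
  ultimately have "bij_betw F (?X // ?r) (carrier (H2 K lam A M rho))"
    by (simp add: bij_betw_def)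
  moreover have "F (?r `` {X}) = B #>\<^bsub>Z\<^esub> section_cocycle A M X s" if "X \<in> ?X" "s \<in> sections K A X" for X s
    using F[OF that(1)] chi[OF that] by simp
  ultimately show ?thesis by blast
qed

end
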